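(* Suppose an orthogonal array $OA(N,m-1,3,2)$ exists. Then there is a plan $\mathcal{P}_m$ such that: (a) $\mathcal{P}_m$ is a connected plan orthogonal through the block factor (POTB) for a $3^{3m}$ experiment in $3N$ blocks; among the blocks, $2N$ are of size $4$, while the remaining $N$ are of size $2$ each; (b) $\mathcal{P}_m$ is universally optimal among all plans for the same experiment on the same set up (i.e. for a $3^{3m}$ experiment in $3N$ blocks, $2N$ of size $4$ and $N$ of size $2$).
   Context: An $OA(N,k,s,2)$ is a $k\times N$ array with entries from a set of $s$ symbols such that in any two distinct rows each ordered pair of symbols occurs equally often as a column (and in each row each symbol occurs equally often). A blocked plan for an $s^m$ experiment has a set $\mathcal{T}$ of $m$ treatment factors, each with $s$ levels, and $n$ runs (level combinations, repetitions allowed) partitioned into $b$ blocks of sizes $k_1,\dots,k_b$, $n=\sum_j k_j$. For $A,A'\in\mathcal{T}$, $N_{AA'}$ is the $s\times s$ matrix whose $(p,q)$ entry is the number of runs with $A$ at level $p$ and $A'$ at level $q$; $L_A$ is the $s\times b$ matrix whose $(p,j)$ entry is the number of runs in block $j$ with $A$ at level $p$; $D_k=\mathrm{diag}(k_1,\dots,k_b)$. Factors $A\ne A'$ are orthogonal through the block factor if $N_{AA'}=L_AD_k^{-1}L_{A'}'$. The plan is a POTB if every two distinct treatment factors are orthogonal through the block factor. For each $A$ let $O_A$ be an $(s-1)\times s$ matrix with $O_AO_A'=I_{s-1}$ and $O_A1_s=0$. The C-matrix of the contrasts of a plan $\mathcal{P}$ is $\tilde C(\mathcal{P})=(\tilde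 C_{AA'})_{A,A'\in\mathcal{T}}$ with $\tilde C_{AA'}=O_A\big(N_{AA'}-L_AD_k^{-1}L_{A'}'\big)O_{A'}'$, a square matrix of order $v=\sum_{A\in\mathcal{T}}(s-1)$. A plan is connected if every main effect contrast of every treatment factor is estimable (equivalently $\tilde C(\mathcal{P})$ is nonsingular); only connected plans are considered as competitors. A plan $\mathcal{P}^*$ is universally optimal (for inference on all main effect contrasts) in a class $\Pi$ containing it if $\Phi(\tilde C(\mathcal{P}^* ))\le\Phi(\tilde C(\mathcal{P}))$ for all $\mathcal{P}\in\Pi$ and every function $\Phi:\{v\times v \text{ nonnegative definite matrices}\}\to(-\infty,\infty]$ such that (i) $\Phi$ is convex, (ii) $\Phi(\beta C)$ is non-increasing in $\beta>0$ for each $C$, (iii) $\Phi(UCU')=\Phi(C)$ for every orthogonal matrix $U$. *)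

theory Defs
  imports "Jordan_Normal_Form.Matrix" "HOL-Library.Extended_Real"
begin

text \<open>Symbols, levels, rows, columns, factors, runs and blocks are all numbered from 0.\<close>

definition is_OA :: "nat \<Rightarrow> nat \<Rightarrow> nat \<Rightarrow> nat mat \<Rightarrow> bool" where
  "is_OA N k s X \<longleftrightarrow>
     X \<in> carrier_mat k N \<and>
     (\<forall>i<k. \<forall>c<N. X $$ (i,c) < s) \<and>
     (\<forall>i<k. \<exists>l. \<forall>p<s. card {c. c < N \<and> X $$ (i,c) = p} = l) \<and>
     (\<forall>i<k. \<forall>i'<k. i \<noteq> i' \<longrightarrow>
        (\<exists>l. \<forall>p<s. \<forall>q<s. card {c. c < N \<and> X $$ (i,c) = p \<and> X $$ (i',c) = q} = l))"

text \<open>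
  A plan lists its runs \<open>u < runs P\<close>; run \<open>u\<close> lies in block \<open>blk P u\<close> and has factor \<open>A\<close> at level
  \<open>lev P A u\<close>. Different runs may carry the same level combination.
\<close>

record plan =
  runs :: nat
  blk :: "nat \<Rightarrow> nat"
  lev :: "nat \<Rightarrow> nat \<Rightarrow> nat"

definition block_size :: "plan \<Rightarrow> nat \<Rightarrow> nat" where
  "block_size P j = card {u. u < runs P \<and> blk P u = j}"

text \<open>A plan for an \<open>s\<^sup>t\<close> experiment in \<open>b\<close> (nonempty) blocks.\<close>

definition blocked_plan :: "nat \<Rightarrow> nat \<Rightarrow> nat \<Rightarrow> plan \<Rightarrow> bool" where
  "blocked_plan s t b P \<longleftrightarrow>
     (\<forall>u<runs P. blk P u < b \<and> (\<forall>A<t. lev P A u < s)) \<and>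
     (\<forall>j<b. 0 < block_size P j)"

definition N_mat :: "nat \<Rightarrow> plan \<Rightarrow> nat \<Rightarrow> nat \<Rightarrow> real mat" where
  "N_mat s P A A' =
     mat s s (\<lambda>(p,q). real (card {u. u < runs P \<and> lev P A u = p \<and> lev P A' u = q}))"

definition L_mat :: "nat \<Rightarrow> nat \<Rightarrow> plan \<Rightarrow> nat \<Rightarrow> real mat" where
  "L_mat s b P A = mat s b (\<lambda>(p,j). real (card {u. u < runs P \<and> blk P u = j \<and> lev P A u = p}))"

definition Dk_inv :: "nat \<Rightarrow> plan \<Rightarrow> real mat" where
  "Dk_inv b P = mat_diag b (\<lambda>j. 1 / real (block_size P j))"

definition orthogonal_through_blocks :: "nat \<Rightarrow> nat \<Rightarrow> plan \<Rightarrow> nat \<Rightarrow> nat \<Rightarrow> bool" where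
  "orthogonal_through_blocks s b P A A' \<longleftrightarrow>
     N_mat s P A A' = L_mat s b P A * Dk_inv b P * transpose_mat (L_mat s b P A')"

definition POTB :: "nat \<Rightarrow> nat \<Rightarrow> nat \<Rightarrow> plan \<Rightarrow> bool" where
  "POTB s t b P \<longleftrightarrow> (\<forall>A<t. \<forall>A'<t. A \<noteq> A' \<longrightarrow> orthogonal_through_blocks s b P A A')"

text \<open>
  Estimability refers to the additive fixed-effects model in which the expected response of run \<open>u\<close>
  is \<open>\<beta> (blk P u) + (\<Sum>A<t. \<tau> A (lev P A u))\<close>; a general mean would be absorbed by the block
  effects \<open>\<beta>\<close>. The combination \<open>\<Sum>p<s. c p * \<tau> A p\<close> is estimable iff it has a linear
  unbiased estimator, with weights \<open>a\<close> on the responses.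
\<close>

definition estimable :: "nat \<Rightarrow> nat \<Rightarrow> plan \<Rightarrow> nat \<Rightarrow> (nat \<Rightarrow> real) \<Rightarrow> bool" where
  "estimable s t P A c \<longleftrightarrow>
     (\<exists>a :: nat \<Rightarrow> real. \<forall>(\<beta> :: nat \<Rightarrow> real) (\<tau> :: nat \<Rightarrow> nat \<Rightarrow> real).
        (\<Sum>u<runs P. a u * (\<beta> (blk P u) + (\<Sum>B<t. \<tau> B (lev P B u)))) = (\<Sum>p<s. c p * \<tau> A p))"

definition connected_plan :: "nat \<Rightarrow> nat \<Rightarrow> plan \<Rightarrow> bool" where
  "connected_plan s t P \<longleftrightarrow>
     (\<forall>A<t. \<forall>c :: nat \<Rightarrow> real. (\<Sum>p<s. c p) = 0 \<longrightarrow> estimable s t P A c)"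

definition contrast_mat :: "nat \<Rightarrow> real mat \<Rightarrow> bool" where
  "contrast_mat s H \<longleftrightarrow>
     H \<in> carrier_mat (s - 1) s \<and>
     H * transpose_mat H = 1\<^sub>m (s - 1) \<and>
     H *\<^sub>v vec s (\<lambda>_. 1) = 0\<^sub>v (s - 1)"

definition C_block :: "nat \<Rightarrow> nat \<Rightarrow> (nat \<Rightarrow> real mat) \<Rightarrow> plan \<Rightarrow> nat \<Rightarrow> nat \<Rightarrow> real mat" where
  "C_block s b H P A A' =
     H A * (N_mat s P A A' - L_mat s b P A * Dk_inv b P * transpose_mat (L_mat s b P A'))
       * transpose_mat (H A')"

text \<open>Row \<open>i\<close> of the partitioned matrix is row \<open>i mod (s - 1)\<close> of the block row of factor
  \<open>i div (s - 1)\<close>; likewise for columns.\<close>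

definition C_mat :: "nat \<Rightarrow> nat \<Rightarrow> nat \<Rightarrow> (nat \<Rightarrow> real mat) \<Rightarrow> plan \<Rightarrow> real mat" where
  "C_mat s t b H P =
     mat (t * (s - 1)) (t * (s - 1)) (\<lambda>(i,j).
       C_block s b H P (i div (s - 1)) (j div (s - 1)) $$ (i mod (s - 1), j mod (s - 1)))"

definition nnd_mats :: "nat \<Rightarrow> real mat set" where
  "nnd_mats v = {C \<in> carrier_mat v v. transpose_mat C = C \<and>
     (\<forall>x\<in>carrier_vec v. 0 \<le> x \<bullet> (C *\<^sub>v x))}"

text \<open>The functions \<open>\<Phi>\<close> occurring in universal optimality; only the values of \<open>\<Phi>\<close> on \<open>nnd_mats v\<close>
  matter.\<close>

definition optimality_criterion :: "nat \<Rightarrow> (real mat \<Rightarrow> ereal) \<Rightarrow> bool" where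
  "optimality_criterion v \<Phi> \<longleftrightarrow>
     (\<forall>C\<in>nnd_mats v. \<Phi> C \<noteq> -\<infinity>) \<and>
     (\<forall>C\<in>nnd_mats v. \<forall>D\<in>nnd_mats v. \<forall>x::real. 0 < x \<and> x < 1 \<longrightarrow>
        \<Phi> (x \<cdot>\<^sub>m C + (1 - x) \<cdot>\<^sub>m D) \<le> ereal x * \<Phi> C + ereal (1 - x) * \<Phi> D) \<and>
     (\<forall>C\<in>nnd_mats v. \<forall>x y::real. 0 < x \<and> x \<le> y \<longrightarrow> \<Phi> (y \<cdot>\<^sub>m C) \<le> \<Phi> (x \<cdot>\<^sub>m C)) \<and>
     (\<forall>C\<in>nnd_mats v. \<forall>U\<in>carrier_mat v v.
        U * transpose_mat U = 1\<^sub>m v \<and> transpose_mat U * U = 1\<^sub>m v \<longrightarrow>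
        \<Phi> (U * C * transpose_mat U) = \<Phi> C)"

definition universally_optimal ::
    "nat \<Rightarrow> nat \<Rightarrow> nat \<Rightarrow> (nat \<Rightarrow> real mat) \<Rightarrow> plan set \<Rightarrow> plan \<Rightarrow> bool" where
  "universally_optimal s t b H K P \<longleftrightarrow>
     P \<in> K \<and>
     (\<forall>Q\<in>K. \<forall>\<Phi>. optimality_criterion (t * (s - 1)) \<Phi> \<longrightarrow>
        \<Phi> (C_mat s t b H P) \<le> \<Phi> (C_mat s t b H Q))"

definition plans_on_setup :: "nat \<Rightarrow> nat \<Rightarrow> plan set" where
  "plans_on_setup m N = {P. blocked_plan 3 (3 * m) (3 * N) P \<and>
     card {j. j < 3 * N \<and> block_size P j = 4} = 2 * N \<and>
     card {j. j < 3 * N \<and> block_size P j = 2} = N}"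

end

theory Submission
  imports Defs "Jordan_Normal_Form.Determinant" "HOL-Number_Theory.Cong"
begin

text \<open>
The plan is built from one small plan, the cell, for three factors in blocks of sizes 4, 4 and 2
(\<open>cell_plan\<close>). Write \<open>D\<close> for the diagonal matrix of the
reciprocal block sizes and \<open>J\<close> for the matrix of ones. For two factors of the cell the matrix
\<open>N - L D L'\<close> is zero if they differ and \<open>3 I - J\<close> if they are equal (\<open>cell_plan_info\<close>). Take one copy of the cell for each of the \<open>N\<close>
columns of the array, and let \<open>m\<close> groups of three factors each run through the cell
simultaneously. In copy \<open>c\<close> the levels of a group are shifted cyclically by the entry in column \<open>c\<close>
of the row of the array for this group; one group needs no row and is not shifted. Since
\<open>N - L D L'\<close> is additive over copies, and \<open>3 I - J\<close> is invariant under common shifts and cancels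
when the two shifts are balanced against each other, all distinct factors are orthogonal
through the blocks and each factor has the matrix \<open>N (3 I - J)\<close>
(\<open>shifted_cells_equal_info\<close>). Hence the plan is connected and its C-matrix is \<open>3 N I\<close>.

For optimality, averaging any nonnegative definite matrix over sign changes and cyclic rotations of
the coordinates turns it into the multiple of the identity with the same trace, and by convexity
and orthogonal invariance no criterion increases. By monotonicity a multiple of the identity
is therefore at least as good as every matrix of smaller or equal positive trace
(\<open>criterion_scalar_matrix_le\<close>). The trace of a C-matrix is a sum over factors and
blocks, to which a block of size 4 contributes at most \<open>5/2\<close> and a block of size 2 at most \<open>1\<close>
(\<open>C_mat_trace\<close>, \<open>info_trace\<close>, \<open>block_information_le\<close>). This gives at most
\<open>6 N\<close> for each factor, which is the trace of \<open>3 N I\<close> on the two contrasts of a factor. The trace of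
a connected plan is positive (\<open>connected_info_trace_pos\<close>).
\<close>

section \<open>Functions of the runs adjusted for blocks\<close>

definition block_mean :: "plan \<Rightarrow> (nat \<Rightarrow> real) \<Rightarrow> nat \<Rightarrow> real" where
  "block_mean P f j = (\<Sum>u | u < runs P \<and> blk P u = j. f u) / real (block_size P j)"

text \<open>The inner product of two functions of the runs after block effects have been projected out. The
matrices \<open>N - L D L'\<close> and the C-matrix have entries of this form, which makes their symmetry,
nonnegative definiteness and zero row sums visible.\<close>

definition within_block_product :: "plan \<Rightarrow> (nat \<Rightarrow> real) \<Rightarrow> (nat \<Rightarrow> real) \<Rightarrow> real" where
  "within_block_product P f g =
     (\<Sum>u<runs P. (f u - block_mean P f (blk P u)) * (g u - block_mean P g (blk P u)))"

lemma sum_runs_by_block: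
  fixes f :: "nat \<Rightarrow> real"
  assumes "\<forall>u<runs P. blk P u < b"
  shows "(\<Sum>u<runs P. f u) = (\<Sum>j<b. \<Sum>u | u < runs P \<and> blk P u = j. f u)"
proof -
  have "(\<Sum>j<b. \<Sum>u | u \<in> {..<runs P} \<and> blk P u = j. f u) = (\<Sum>u<runs P. f u)"
    by (rule sum.group) (use assms in auto)
  then show ?thesis by simp
qed

lemma block_size_pos:
  assumes "u < runs P"
  shows "0 < block_size P (blk P u)"
  unfolding block_size_def card_gt_0_iff using assms by auto

lemma block_mean_times_size:
  "real (block_size P j) * block_mean P f j = (\<Sum>u | u < runs P \<and> blk P u = j. f u)"
proof (cases "block_size P j = 0")
  case True
  then have "{u. u < runs P \<and> blk P u = j} = {}"
    unfolding block_size_def by (subst (asm) card_0_eq) auto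
  with True show ?thesis by (simp only: sum.empty)
qed (simp add: block_mean_def)

text \<open>A centred function is orthogonal to every function of the blocks, because its values add up to zero
in each block.\<close>

lemma sum_centred_times_block_function:
  fixes f \<beta> :: "nat \<Rightarrow> real"
  shows "(\<Sum>u<runs P. (f u - block_mean P f (blk P u)) * \<beta> (blk P u)) = 0"
proof -
  define b where "b = Suc (Max (insert 0 (blk P ` {..<runs P})))"
  have b: "\<forall>u<runs P. blk P u < b"
    unfolding b_def by (auto simp: less_Suc_eq_le intro!: Max_ge)
  have "(\<Sum>u | u < runs P \<and> blk P u = j. (f u - block_mean P f (blk P u)) * \<beta> (blk P u)) = 0" for j
  proof -
    have "(\<Sum>u | u < runs P \<and> blk P u = j. (f u - block_mean P f (blk P u)) * \<beta> (blk P u))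
        = (\<Sum>u | u < runs P \<and> blk P u = j. f u - block_mean P f j) * \<beta> j"
      unfolding sum_distrib_right by (rule sum.cong) auto
    also have "(\<Sum>u | u < runs P \<and> blk P u = j. f u - block_mean P f j) = 0"
      using block_mean_times_size[of P j f] by (simp add: sum_subtractf block_size_def)
    finally show ?thesis by simp
  qed
  then show ?thesis
    by (subst sum_runs_by_block[OF b]) simp
qed

text \<open>An orthogonal projection is self-adjoint and idempotent, so that centring one of the two functions is enough.\<close>

lemma within_block_product_left:
  "within_block_product P f g = (\<Sum>u<runs P. (f u - block_mean P f (blk P u)) * g u)"
  using sum_centred_times_block_function[where P = P and f = f and \<beta> = "block_mean P g"]
  by (simp add: within_block_product_def right_diff_distrib sum_subtractf)

lemma within_block_product_commute:
  "within_block_product P f g = within_block_product P g f"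
  by (simp add: within_block_product_def mult.commute)

lemma within_block_product_explicit:
  assumes "\<forall>u<runs P. blk P u < b"
  shows "within_block_product P f g =
    (\<Sum>u<runs P. f u * g u) -
    (\<Sum>j<b. (\<Sum>u | u < runs P \<and> blk P u = j. f u) * (\<Sum>u | u < runs P \<and> blk P u = j. g u)
       / real (block_size P j))"
proof -
  have "(\<Sum>u<runs P. block_mean P f (blk P u) * g u)
     = (\<Sum>j<b. (\<Sum>u | u < runs P \<and> blk P u = j. block_mean P f (blk P u) * g u))"
    by (rule sum_runs_by_block[OF assms])
  also have "\<dots> = (\<Sum>j<b. block_mean P f j * (\<Sum>u | u < runs P \<and> blk P u = j. g u))"
    unfolding sum_distrib_left by (intro sum.cong) auto
  finally show ?thesis
    by (simp add: within_block_product_left left_diff_distrib sum_subtractf block_mean_def)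
qed

lemma within_block_product_sum_right:
  "within_block_product P f (\<lambda>u. \<Sum>i\<in>I. c i * g i u) = (\<Sum>i\<in>I. c i * within_block_product P f (g i))"
proof -
  have "within_block_product P f (\<lambda>u. \<Sum>i\<in>I. c i * g i u)
      = (\<Sum>u<runs P. \<Sum>i\<in>I. c i * ((f u - block_mean P f (blk P u)) * g i u))"
    by (simp add: within_block_product_left sum_distrib_left mult_ac)
  also have "\<dots> = (\<Sum>i\<in>I. c i * within_block_product P f (g i))"
    by (subst sum.swap) (simp add: within_block_product_left sum_distrib_left)
  finally show ?thesis .
qed

lemma within_block_product_sum_left:
  "within_block_product P (\<lambda>u. \<Sum>i\<in>I. c i * f i u) g = (\<Sum>i\<in>I. c i * within_block_product P (f i) g)"
  unfolding within_block_product_commute[of P _ g] by (rule within_block_product_sum_right)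

lemma within_block_product_self_nonneg: "0 \<le> within_block_product P f f"
  by (simp add: within_block_product_def sum_nonneg)

lemma within_block_product_const_left: "within_block_product P (\<lambda>_. a) g = 0"
proof -
  have "a = block_mean P (\<lambda>_. a) (blk P u)" if "u < runs P" for u
    using block_size_pos[OF that] unfolding block_mean_def sum_constant
    by (simp add: block_size_def[symmetric])
  then show ?thesis unfolding within_block_product_def by (intro sum.neutral) auto
qed

section \<open>The information matrices of pairs of factors\<close>

text \<open>The entry in position \<open>(p,q)\<close> of the matrix \<open>N - L D L'\<close> of the factors \<open>A\<close> and \<open>B\<close>
(\<open>info_matrix_entry\<close>), written as the product of two level indicators.\<close>

definition info :: "plan \<Rightarrow> nat \<Rightarrow> nat \<Rightarrow> nat \<Rightarrow> nat \<Rightarrow> real" where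
  "info P A B p q =
     within_block_product P (\<lambda>u. of_bool (lev P A u = p)) (\<lambda>u. of_bool (lev P B u = q))"

lemma sum_level_indicators:
  fixes f :: "nat \<Rightarrow> real"
  assumes "l < s"
  shows "(\<Sum>p<s. f p * of_bool (l = p)) = f l"
proof -
  have "(\<Sum>p<s. f p * of_bool (l = p)) = (\<Sum>p<s. if l = p then f p else 0)"
    by (rule sum.cong) auto
  then show ?thesis using assms by simp
qed

lemma within_block_product_cong:
  assumes "\<And>u. u < runs P \<Longrightarrow> f u = f' u" "\<And>u. u < runs P \<Longrightarrow> g u = g' u"
  shows "within_block_product P f g = within_block_product P f' g'"
proof -
  have "block_mean P f = block_mean P f'" "block_mean P g = block_mean P g'"
    unfolding block_mean_def using assms by (auto intro!: ext arg_cong2[of _ _ _ _ "(/)"] sum.cong)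
  then show ?thesis unfolding within_block_product_def using assms by (auto intro!: sum.cong)
qed

text \<open>A function of the levels of one factor is a linear combination of its level indicators; hence the
bilinear form of \<open>info\<close> is the within-block product of the two functions.\<close>

lemma within_block_product_levels:
  assumes "\<forall>u<runs P. lev P A u < s" "\<forall>u<runs P. lev P B u < s"
  shows "within_block_product P (\<lambda>u. f (lev P A u)) (\<lambda>u. g (lev P B u))
       = (\<Sum>p<s. \<Sum>q<s. f p * g q * info P A B p q)"
proof -
  have "within_block_product P (\<lambda>u. f (lev P A u)) (\<lambda>u. g (lev P B u))
     = within_block_product P (\<lambda>u. \<Sum>p<s. f p * of_bool (lev P A u = p))
         (\<lambda>u. \<Sum>q<s. g q * of_bool (lev P B u = q))"
    by (intro within_block_product_cong; subst sum_level_indicators) (use assms in auto)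
  also have "\<dots> = (\<Sum>p<s. \<Sum>q<s. f p * g q * info P A B p q)"
    unfolding within_block_product_sum_left within_block_product_sum_right info_def
    by (simp add: sum_distrib_left mult.assoc)
  finally show ?thesis .
qed

lemma card_eq_sum_of_bool:
  fixes n :: nat
  shows "real (card {u. u < n \<and> R u}) = (\<Sum>u<n. of_bool (R u))"
  by (subst sum_of_bool_eq) (auto intro!: arg_cong[where f=card])

lemma card_block_eq_sum_of_bool:
  fixes n :: nat
  shows "real (card {u. u < n \<and> k u = j \<and> R u}) = (\<Sum>u | u < n \<and> k u = j. of_bool (R u))"
  by (subst sum_of_bool_eq) (auto intro!: arg_cong[where f=card])

lemma LDL_entry:
  assumes "p < s" "q < s"
  shows "(L_mat s b P A * Dk_inv b P * transpose_mat (L_mat s b P B)) $$ (p,q)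
    = (\<Sum>j<b. (\<Sum>u | u < runs P \<and> blk P u = j. of_bool (lev P A u = p)) *
              (\<Sum>u | u < runs P \<and> blk P u = j. of_bool (lev P B u = q)) / real (block_size P j))"
proof -
  have "Dk_inv b P \<in> carrier_mat b b" "L_mat s b P A \<in> carrier_mat s b"
    by (auto simp: Dk_inv_def L_mat_def)
  have 1: "L_mat s b P A * Dk_inv b P = mat s b (\<lambda>(p,j). L_mat s b P A $$ (p,j) * (1 / real (block_size P j)))"
    unfolding Dk_inv_def by (rule mat_diag_mult_right) (auto simp: L_mat_def)
  show ?thesis unfolding 1
    using assms
    by (auto simp: L_mat_def scalar_prod_def card_block_eq_sum_of_bool lessThan_atLeast0 intro!: sum.cong)
qed

lemma info_matrix_entry:
  assumes "\<forall>u<runs P. blk P u < b" "p < s" "q < s"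
  shows "(N_mat s P A B - L_mat s b P A * Dk_inv b P * transpose_mat (L_mat s b P B)) $$ (p,q)
       = info P A B p q"
proof -
  have "N_mat s P A B $$ (p,q) = (\<Sum>u<runs P. of_bool (lev P A u = p) * of_bool (lev P B u = q))"
    using assms by (simp add: N_mat_def card_eq_sum_of_bool of_bool_conj)
  then show ?thesis
    using assms LDL_entry[of p s q b P A B] unfolding info_def within_block_product_explicit[OF assms(1)]
    by (subst index_minus_mat) (auto simp: L_mat_def Dk_inv_def)
qed

lemma orthogonal_through_blocksI:
  assumes "\<forall>u<runs P. blk P u < b" "\<And>p q. p < s \<Longrightarrow> q < s \<Longrightarrow> info P A B p q = 0"
  shows "orthogonal_through_blocks s b P A B"
  unfolding orthogonal_through_blocks_def
proof (rule eq_matI)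
  let ?R = "L_mat s b P A * Dk_inv b P * transpose_mat (L_mat s b P B)"
  show "dim_row (N_mat s P A B) = dim_row ?R" "dim_col (N_mat s P A B) = dim_col ?R"
    by (auto simp: L_mat_def N_mat_def)
  fix p q assume "p < dim_row ?R" "q < dim_col ?R"
  then have pq: "p < s" "q < s" by (auto simp: L_mat_def)
  have "(N_mat s P A B - ?R) $$ (p,q) = 0"
    using info_matrix_entry[OF assms(1) pq] assms(2)[OF pq] by simp
  then show "N_mat s P A B $$ (p,q) = ?R $$ (p,q)"
    using pq by (subst (asm) index_minus_mat) (auto simp: L_mat_def N_mat_def)
qed

lemma bilinear_entry:
  fixes H K M :: "real mat"
  assumes "H \<in> carrier_mat r s" "K \<in> carrier_mat r' s" "M \<in> carrier_mat s s" "i < r" "j < r'"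
  shows "(H * M * transpose_mat K) $$ (i,j) = (\<Sum>p<s. \<Sum>q<s. H $$ (i,p) * K $$ (j,q) * M $$ (p,q))"
proof -
  have "H * M * transpose_mat K = H * (M * transpose_mat K)"
    using assms by (intro assoc_mult_mat) auto
  then show ?thesis
    using assms by (simp add: scalar_prod_def lessThan_atLeast0 sum_distrib_left mult_ac)
qed

lemma C_block_entry:
  assumes "\<forall>u<runs P. blk P u < b" "contrast_mat s (H A)" "contrast_mat s (H B)" "i < s - 1" "j < s - 1"
  shows "C_block s b H P A B $$ (i,j) = (\<Sum>p<s. \<Sum>q<s. H A $$ (i,p) * H B $$ (j,q) * info P A B p q)"
proof -
  have "H A \<in> carrier_mat (s-1) s" "H B \<in> carrier_mat (s-1) s"
    using assms by (auto simp: contrast_mat_def)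
  moreover have "N_mat s P A B - L_mat s b P A * Dk_inv b P * transpose_mat (L_mat s b P B) \<in> carrier_mat s s"
    by (rule minus_carrier_mat) (auto simp: L_mat_def)
  ultimately show ?thesis
    using assms(4,5) unfolding C_block_def
    by (subst bilinear_entry) (auto simp: info_matrix_entry[OF assms(1)] simp del: index_minus_mat intro!: sum.cong)
qed

lemma C_mat_entry:
  assumes "\<forall>u<runs P. blk P u < b" "\<forall>A<t. contrast_mat s (H A)" "i < t * (s - 1)" "j < t * (s - 1)"
  shows "C_mat s t b H P $$ (i,j) =
     (\<Sum>p<s. \<Sum>q<s. H (i div (s-1)) $$ (i mod (s-1), p) * H (j div (s-1)) $$ (j mod (s-1), q) *
        info P (i div (s-1)) (j div (s-1)) p q)"
proof -
  have "s - 1 > 0" using assms(3) by (cases "s - 1") auto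
  moreover have "i div (s-1) < t" "j div (s-1) < t"
    using assms(3,4) less_mult_imp_div_less by blast+
  ultimately show ?thesis
    using assms by (simp add: C_mat_def C_block_entry)
qed

section \<open>Nonnegative definiteness and trace of the C-matrix\<close>

text \<open>Row \<open>i\<close> of the matrix of contrasts belongs to one normalized contrast of one factor. Evaluating
this contrast at the runs turns \<open>C_mat\<close> into a Gram matrix, which makes it nonnegative definite.\<close>

lemma C_mat_as_gram:
  assumes "blocked_plan s t b P" "\<forall>A<t. contrast_mat s (H A)" "i < t * (s - 1)" "j < t * (s - 1)"
  shows "C_mat s t b H P $$ (i,j) =
     within_block_product P
       (\<lambda>u. H (i div (s-1)) $$ (i mod (s-1), lev P (i div (s-1)) u))
       (\<lambda>u. H (j div (s-1)) $$ (j mod (s-1), lev P (j div (s-1)) u))"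
proof -
  have "i div (s-1) < t" "j div (s-1) < t"
    using assms(3,4) less_mult_imp_div_less by blast+
  then show ?thesis
    using assms
    by (subst C_mat_entry, simp_all add: blocked_plan_def, subst within_block_product_levels, auto)
qed

lemma C_mat_nnd:
  assumes "blocked_plan s t b P" "\<forall>A<t. contrast_mat s (H A)"
  shows "C_mat s t b H P \<in> nnd_mats (t * (s - 1))"
proof -
  let ?v = "t * (s - 1)" and ?C = "C_mat s t b H P"
  define h where "h i u = H (i div (s-1)) $$ (i mod (s-1), lev P (i div (s-1)) u)" for i u
  have C: "?C \<in> carrier_mat ?v ?v" by (simp add: C_mat_def)
  have entry: "?C $$ (i,j) = within_block_product P (h i) (h j)" if "i < ?v" "j < ?v" for i j
    using C_mat_as_gram[OF assms that] by (simp add: h_def[abs_def])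
  have "transpose_mat ?C = ?C"
    using C by (intro eq_matI) (auto simp: entry intro: within_block_product_commute)
  moreover have "0 \<le> x \<bullet> (?C *\<^sub>v x)" if "x \<in> carrier_vec ?v" for x
  proof -
    have "x \<bullet> (?C *\<^sub>v x) = (\<Sum>i<?v. x $ i * (\<Sum>j<?v. x $ j * within_block_product P (h i) (h j)))"
      using that C unfolding scalar_prod_def lessThan_atLeast0
      by (auto simp: scalar_prod_def entry mult_ac simp del: mult_eq_0_iff intro!: sum.cong)
    also have "\<dots> = within_block_product P (\<lambda>u. \<Sum>i<?v. x $ i * h i u) (\<lambda>u. \<Sum>j<?v. x $ j * h j u)"
      by (simp only: within_block_product_sum_left within_block_product_sum_right)
    finally show ?thesis using within_block_product_self_nonneg by simp
  qed
  ultimately show ?thesis using C by (simp add: nnd_mats_def)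
qed

lemma contrast_mat_rows_orthonormal:
  assumes "contrast_mat s H" "k < s - 1" "l < s - 1"
  shows "(\<Sum>p<s. H $$ (k,p) * H $$ (l,p)) = of_bool (k = l)"
proof -
  have "(H * transpose_mat H) $$ (k,l) = of_bool (k = l)" "H \<in> carrier_mat (s-1) s"
    using assms by (simp_all add: contrast_mat_def)
  then show ?thesis using assms(2,3) by (simp add: scalar_prod_def lessThan_atLeast0)
qed

lemma contrast_mat_row_sum:
  assumes "contrast_mat s H" "k < s - 1"
  shows "(\<Sum>p<s. H $$ (k,p)) = 0"
proof -
  have "(H *\<^sub>v vec s (\<lambda>_. 1)) $ k = 0" "H \<in> carrier_mat (s-1) s"
    using assms by (simp_all add: contrast_mat_def)
  then show ?thesis using assms(2) by (simp add: scalar_prod_def lessThan_atLeast0)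
qed

text \<open>Adding the constant row \<open>1 / sqrt s\<close> to a contrast matrix gives an orthogonal square matrix. Its
columns are then orthonormal as well, and removing the constant row subtracts \<open>1 / s\<close>.\<close>

lemma contrast_mat_gram:
  assumes "contrast_mat s H" "p < s" "q < s"
  shows "(\<Sum>k<s-1. H $$ (k,p) * H $$ (k,q)) = of_bool (p = q) - 1 / real s"
proof -
  define B where "B = mat s s (\<lambda>(k,p). if k < s - 1 then H $$ (k,p) else 1 / sqrt (real s))"
  have s: "0 < s" using assms by simp
  note rows = contrast_mat_rows_orthonormal[OF assms(1)] and row0 = contrast_mat_row_sum[OF assms(1)]
  have B: "B \<in> carrier_mat s s" by (simp add: B_def)
  have "B * transpose_mat B = 1\<^sub>m s"
  proof (rule eq_matI)
    fix k l assume "k < dim_row (1\<^sub>m s :: real mat)" "l < dim_col (1\<^sub>m s :: real mat)"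
    then have kl: "k < s" "l < s" by auto
    then have "(B * transpose_mat B) $$ (k,l) = (\<Sum>p<s. B $$ (k,p) * B $$ (l,p))"
      using B by (simp add: scalar_prod_def lessThan_atLeast0)
    also have "\<dots> = of_bool (k = l)"
    proof (cases "k < s - 1"; cases "l < s - 1")
      assume "k < s - 1" "l < s - 1"
      then show ?thesis using kl rows by (simp add: B_def)
    next
      assume a: "k < s - 1" "\<not> l < s - 1"
      then have "(\<Sum>p<s. B $$ (k,p) * B $$ (l,p)) = (\<Sum>p<s. H $$ (k,p)) * (1 / sqrt (real s))"
        using kl unfolding sum_distrib_right by (simp add: B_def)
      then show ?thesis using a row0 by auto
    next
      assume a: "\<not> k < s - 1" "l < s - 1"
      then have "(\<Sum>p<s. B $$ (k,p) * B $$ (l,p)) = (\<Sum>p<s. H $$ (l,p)) * (1 / sqrt (real s))"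
        using kl unfolding sum_distrib_right by (simp add: B_def)
      then show ?thesis using a row0 by auto
    next
      assume a: "\<not> k < s - 1" "\<not> l < s - 1"
      then have "k = l" using kl by simp
      moreover have "(\<Sum>p<s. B $$ (k,p) * B $$ (l,p)) = 1"
        using a kl s by (simp add: B_def)
      ultimately show ?thesis by simp
    qed
    finally show "(B * transpose_mat B) $$ (k,l) = 1\<^sub>m s $$ (k,l)" using kl by simp
  qed (auto simp: B_def)
  then have "transpose_mat B * B = 1\<^sub>m s"
    using mat_mult_left_right_inverse B by (metis transpose_carrier_mat)
  then have "(transpose_mat B * B) $$ (p,q) = of_bool (p = q)"
    using assms(2,3) by simp
  then have "(\<Sum>k<s. B $$ (k,p) * B $$ (k,q)) = of_bool (p = q)"
    using assms(2,3) B by (simp add: scalar_prod_def lessThan_atLeast0)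
  moreover have "(\<Sum>k<s. B $$ (k,p) * B $$ (k,q))
      = (\<Sum>k<s-1. B $$ (k,p) * B $$ (k,q)) + B $$ (s-1,p) * B $$ (s-1,q)"
    using s by (cases s) auto
  moreover have "(\<Sum>k<s-1. B $$ (k,p) * B $$ (k,q)) = (\<Sum>k<s-1. H $$ (k,p) * H $$ (k,q))"
    using assms(2,3) by (intro sum.cong) (auto simp: B_def)
  moreover have "B $$ (s-1,p) * B $$ (s-1,q) = 1 / real s"
    using assms(2,3) s by (simp add: B_def)
  ultimately show ?thesis by simp
qed

text \<open>The level indicators of a factor add up to a constant, which the blocks absorb.\<close>

lemma info_sum_right:
  assumes "\<forall>u<runs P. lev P B u < s"
  shows "(\<Sum>q<s. info P A B p q) = 0"
proof -
  let ?f = "\<lambda>u. of_bool (lev P A u = p)"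
  have "(\<Sum>q<s. info P A B p q) = within_block_product P ?f (\<lambda>u. \<Sum>q<s. 1 * of_bool (lev P B u = q))"
    unfolding within_block_product_sum_right info_def by simp
  also have "\<dots> = within_block_product P ?f (\<lambda>_. 1)"
    using assms by (intro within_block_product_cong refl) (subst sum_level_indicators; auto)
  finally show ?thesis
    by (simp add: within_block_product_commute[of P ?f] within_block_product_const_left)
qed

text \<open>By \<open>contrast_mat_gram\<close>, compressing a matrix with a contrast matrix changes the trace only by the
mean of all entries, and this is zero by \<open>info_sum_right\<close>. In particular the trace does not
depend on the choice of the contrasts.\<close>

lemma C_mat_trace:
  assumes P: "blocked_plan s t b P" and H: "\<forall>A<t. contrast_mat s (H A)"
  shows "(\<Sum>i<t * (s-1). C_mat s t b H P $$ (i,i)) = (\<Sum>A<t. \<Sum>p<s. info P A A p p)"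
proof -
  have blk: "\<forall>u<runs P. blk P u < b" and lev: "\<And>A. A < t \<Longrightarrow> \<forall>u<runs P. lev P A u < s"
    using P by (auto simp: blocked_plan_def)
  have "(\<Sum>i<t * (s-1). C_mat s t b H P $$ (i,i))
      = (\<Sum>A<t. \<Sum>i = A*(s-1)..<A*(s-1)+(s-1). C_mat s t b H P $$ (i,i))"
    by (rule sum.nat_group[symmetric])
  also have "\<dots> = (\<Sum>A<t. \<Sum>p<s. info P A A p p)"
  proof (rule sum.cong[OF refl])
    fix A assume "A \<in> {..<t}"
    then have A: "A < t" by simp
    have bound: "A * (s-1) + k < t * (s-1)" if "k < s - 1" for k
    proof -
      have "A * (s-1) + k < Suc A * (s-1)" using that by simp
      also have "\<dots> \<le> t * (s-1)" using A by (intro mult_right_mono) auto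
      finally show ?thesis .
    qed
    have "(\<Sum>i = A*(s-1)..<A*(s-1)+(s-1). C_mat s t b H P $$ (i,i))
        = (\<Sum>k<s-1. C_mat s t b H P $$ (A*(s-1)+k, A*(s-1)+k))"
      using sum.shift_bounds_nat_ivl[of "\<lambda>i. C_mat s t b H P $$ (i,i)" 0 "A*(s-1)" "s-1"]
      by (simp add: lessThan_atLeast0 add.commute)
    also have "\<dots> = (\<Sum>k<s-1. \<Sum>p<s. \<Sum>q<s. H A $$ (k,p) * H A $$ (k,q) * info P A A p q)"
      using bound by (intro sum.cong[OF refl], subst C_mat_entry[OF blk H]) auto
    also have "\<dots> = (\<Sum>p<s. \<Sum>k<s-1. \<Sum>q<s. H A $$ (k,p) * H A $$ (k,q) * info P A A p q)"
      by (rule sum.swap)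
    also have "\<dots> = (\<Sum>p<s. \<Sum>q<s. (\<Sum>k<s-1. H A $$ (k,p) * H A $$ (k,q)) * info P A A p q)"
      unfolding sum_distrib_right by (intro sum.cong[OF refl] sum.swap)
    also have "\<dots> = (\<Sum>p<s. \<Sum>q<s. info P A A p q * of_bool (p = q) - 1 / real s * info P A A p q)"
      using H A by (intro sum.cong[OF refl], subst contrast_mat_gram) (auto simp: left_diff_distrib)
    also have "\<dots> = (\<Sum>p<s. info P A A p p)"
      using A by (simp add: sum_subtractf sum_level_indicators sum_divide_distrib[symmetric]
                    info_sum_right[OF lev] del: sum_mult_of_bool_eq sum_of_bool_mult_eq)
    finally show "(\<Sum>i = A*(s-1)..<A*(s-1)+(s-1). C_mat s t b H P $$ (i,i)) = (\<Sum>p<s. info P A A p p)" .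
  qed
  finally show ?thesis .
qed

section \<open>Bounds on the trace\<close>

lemma card_block_by_level:
  assumes "\<forall>u<runs P. lev P A u < s"
  shows "(\<Sum>p<s. card {u. u < runs P \<and> blk P u = j \<and> lev P A u = p}) = block_size P j"
proof -
  have "(\<Sum>p<s. \<Sum>u | u \<in> {u. u < runs P \<and> blk P u = j} \<and> lev P A u = p. 1)
      = (\<Sum>u | u < runs P \<and> blk P u = j. 1 :: nat)"
    by (rule sum.group) (use assms in auto)
  then show ?thesis by (simp add: block_size_def conj_assoc)
qed

text \<open>A block of size \<open>k\<close> in which the levels occur \<open>x 0, ..., x (s - 1)\<close> times contributes
\<open>k - (\<Sum>p. x p ^ 2) / k\<close>, because an indicator is its own square.\<close>

lemma info_trace:
  assumes "blocked_plan s t b P" "A < t"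
  shows "(\<Sum>p<s. info P A A p p) =
    (\<Sum>j<b. real (block_size P j) -
       (\<Sum>p<s. (real (card {u. u < runs P \<and> blk P u = j \<and> lev P A u = p}))\<^sup>2) / real (block_size P j))"
proof -
  have blk: "\<forall>u<runs P. blk P u < b" and lev: "\<forall>u<runs P. lev P A u < s"
    using assms by (auto simp: blocked_plan_def)
  define L where "L p j = real (card {u. u < runs P \<and> blk P u = j \<and> lev P A u = p})" for p j
  have "info P A A p p = (\<Sum>j<b. L p j - (L p j)\<^sup>2 / real (block_size P j))" for p
  proof -
    have "(\<Sum>u<runs P. of_bool (lev P A u = p) * of_bool (lev P A u = p) :: real)
        = (\<Sum>u<runs P. of_bool (lev P A u = p))"
      by (intro sum.cong) auto
    also have "\<dots> = (\<Sum>j<b. L p j)"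
      unfolding L_def card_block_eq_sum_of_bool by (rule sum_runs_by_block[OF blk])
    finally show ?thesis
      unfolding info_def within_block_product_explicit[OF blk]
      by (simp add: L_def card_block_eq_sum_of_bool power2_eq_square sum_subtractf
               del: sum_of_bool_eq sum_of_bool_mult_eq sum_mult_of_bool_eq)
  qed
  then have "(\<Sum>p<s. info P A A p p) = (\<Sum>p<s. \<Sum>j<b. L p j - (L p j)\<^sup>2 / real (block_size P j))"
    by simp
  also have "\<dots> = (\<Sum>j<b. \<Sum>p<s. L p j - (L p j)\<^sup>2 / real (block_size P j))"
    by (rule sum.swap)
  also have "\<dots> = (\<Sum>j<b. real (block_size P j) - (\<Sum>p<s. (L p j)\<^sup>2) / real (block_size P j))"
    using card_block_by_level[OF lev]
    by (intro sum.cong) (auto simp: sum_subtractf L_def sum_divide_distrib simp flip: of_nat_sum)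
  finally show ?thesis by (simp add: L_def)
qed

lemma plans_on_setup_block_sizes:
  assumes "P \<in> plans_on_setup m N" "j < 3 * N"
  shows "block_size P j = 4 \<or> block_size P j = 2"
proof -
  let ?S = "{j. j < 3 * N \<and> block_size P j = 4}" and ?T = "{j. j < 3 * N \<and> block_size P j = 2}"
  have "card (?S \<union> ?T) = 3 * N"
    using assms by (subst card_Un_disjoint) (auto simp: plans_on_setup_def)
  then have "?S \<union> ?T = {..<3*N}"
    by (intro card_subset_eq) auto
  then show ?thesis using assms(2) by auto
qed

text \<open>Frequencies that are as equal as possible minimize the sum of squares: \<open>2, 1, 1\<close> in a block of
size 4 and \<open>1, 1, 0\<close> in a block of size 2. On integers this is the inequality
\<open>(x - 1) (x - 2) \<ge> 0\<close> in the first case and \<open>x (x - 1) \<ge> 0\<close> in the second.\<close>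

lemma block_information_le:
  fixes x :: "nat \<Rightarrow> nat"
  assumes "(\<Sum>p<3. x p) = k" "k = 4 \<or> k = 2"
  shows "real k - (\<Sum>p<3. (real (x p))\<^sup>2) / real k \<le> (if k = 4 then 5/2 else 1)"
proof (cases "k = 4")
  case True
  have "(real (x p) - 1) * (real (x p) - 2) \<ge> 0" for p
    by (cases "x p \<le> 1") (auto simp: le_Suc_eq intro: mult_nonneg_nonneg)
  then have "(real (x p))\<^sup>2 \<ge> 3 * real (x p) - 2" for p
    by (simp add: algebra_simps power2_eq_square)
  then have "(\<Sum>p<3. (real (x p))\<^sup>2) \<ge> (\<Sum>p<3. 3 * real (x p) - 2)"
    by (intro sum_mono)
  also have "(\<Sum>p<3. 3 * real (x p) - 2) = 3 * real (\<Sum>p<3. x p) - 6"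
    by (simp add: sum_subtractf sum_distrib_left)
  finally show ?thesis using assms True by simp
next
  case False
  have "(real (x p))\<^sup>2 \<ge> real (x p)" for p
    by (cases "x p = 0") (auto simp: power2_eq_square)
  then have "(\<Sum>p<3. (real (x p))\<^sup>2) \<ge> (\<Sum>p<3. real (x p))"
    by (intro sum_mono)
  also have "(\<Sum>p<3. real (x p)) = real k"
    using assms by (simp flip: of_nat_sum)
  finally show ?thesis using assms False by simp
qed

lemma info_trace_le:
  assumes "P \<in> plans_on_setup m N" "A < 3 * m"
  shows "(\<Sum>p<3. info P A A p p) \<le> 6 * real N"
proof -
  have P: "blocked_plan 3 (3*m) (3*N) P" using assms by (simp add: plans_on_setup_def)
  then have lev: "\<forall>u<runs P. lev P A u < 3" using assms by (auto simp: blocked_plan_def)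
  have "(\<Sum>p<3. info P A A p p) \<le> (\<Sum>j<3*N. if block_size P j = 4 then 5/2 else 1)"
    unfolding info_trace[OF P assms(2)]
    using plans_on_setup_block_sizes[OF assms(1)] card_block_by_level[OF lev]
    by (intro sum_mono block_information_le) auto
  also have "\<dots> = (\<Sum>j<3*N. 1 + of_bool (block_size P j = 4) * (3/2))"
    by (intro sum.cong) auto
  also have "\<dots> = 3 * real N + real (card {j. j < 3*N \<and> block_size P j = 4}) * (3/2)"
    unfolding sum.distrib card_eq_sum_of_bool sum_distrib_right by simp
  finally show ?thesis using assms(1) by (simp add: plans_on_setup_def)
qed

text \<open>If this trace vanishes, the level of \<open>A\<close> is constant on each block. A change in the effect of one
level can then be cancelled by block effects, so that no contrast involving this level is
estimable. The proof takes level 0.\<close>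

lemma connected_info_trace_pos:
  assumes "connected_plan s t P" "A < t" "2 \<le> s"
  shows "0 < (\<Sum>p<s. info P A A p p)"
proof (rule ccontr)
  let ?f = "\<lambda>u. of_bool (lev P A u = 0) :: real"
  have nonneg: "0 \<le> info P A A p p" for p
    unfolding info_def by (rule within_block_product_self_nonneg)
  assume "\<not> 0 < (\<Sum>p<s. info P A A p p)"
  then have "(\<Sum>p<s. info P A A p p) = 0"
    using sum_nonneg[of "{..<s}" "\<lambda>p. info P A A p p"] nonneg by force
  then have "info P A A 0 0 = 0"
    using nonneg assms(3) by (subst (asm) sum_nonneg_eq_0_iff) auto
  then have const: "\<forall>u<runs P. ?f u - block_mean P ?f (blk P u) = 0"
    unfolding info_def within_block_product_def by (subst (asm) sum_nonneg_eq_0_iff) auto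
  define c where "c p = (if p = 0 then 1 else if p = 1 then -1 else 0 :: real)" for p :: nat
  have "(\<Sum>p<s. c p) = (\<Sum>p\<in>{0,1}. c p)"
    using assms(3) by (intro sum.mono_neutral_right) (auto simp: c_def)
  then have "estimable s t P A c"
    using assms by (simp add: connected_plan_def c_def)
  then obtain a :: "nat \<Rightarrow> real" where a: "\<And>\<beta> \<tau>. (\<Sum>u<runs P. a u * (\<beta> (blk P u) + (\<Sum>B<t. \<tau> B (lev P B u))))
      = (\<Sum>p<s. c p * \<tau> A p)"
    unfolding estimable_def by blast
  \<comment> \<open>the effect of level 0 is 1 and the block effects cancel it in every run\<close>
  have "(\<Sum>B<t. if B = A then of_bool (lev P B u = 0) else 0) = ?f u" for u
    using assms(2) by simp
  then have "(\<Sum>u<runs P. a u * (- block_mean P ?f (blk P u) + ?f u)) = (\<Sum>p<s. c p * of_bool (p = 0))"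
    using a[of "\<lambda>j. - block_mean P ?f j" "\<lambda>B p. if B = A then of_bool (p = 0) else 0"] by simp
  also have "\<dots> = (\<Sum>p\<in>{0}. c p * of_bool (p = 0))"
    using assms(3) by (intro sum.mono_neutral_right) auto
  also have "(\<Sum>u<runs P. a u * (- block_mean P ?f (blk P u) + ?f u)) = 0"
    using const by (intro sum.neutral) auto
  finally show False by (simp add: c_def)
qed

section \<open>Multiples of the identity minimize optimality criteria\<close>

lemma nnd_mats_congruence:
  assumes "C \<in> nnd_mats v" "U \<in> carrier_mat v v"
  shows "U * C * transpose_mat U \<in> nnd_mats v"
proof -
  have C: "C \<in> carrier_mat v v" "transpose_mat C = C" "\<And>x. x \<in> carrier_vec v \<Longrightarrow> 0 \<le> x \<bullet> (C *\<^sub>v x)"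
    using assms by (auto simp: nnd_mats_def)
  have UT: "transpose_mat U \<in> carrier_mat v v" and UC: "U * C \<in> carrier_mat v v"
    using assms C by auto
  have "transpose_mat (U * C * transpose_mat U) = U * (transpose_mat C * transpose_mat U)"
    using assms(2) C(1) by (simp add: transpose_mult[of _ v v _ v])
  then have "transpose_mat (U * C * transpose_mat U) = U * C * transpose_mat U"
    using assms(2) C(1,2) by (simp add: assoc_mult_mat[of _ v v _ v _ v])
  moreover have "0 \<le> x \<bullet> (U * C * transpose_mat U *\<^sub>v x)" if x: "x \<in> carrier_vec v" for x
  proof -
    let ?y = "transpose_mat U *\<^sub>v x"
    have y: "?y \<in> carrier_vec v" using UT x by simp
    have "U * C * transpose_mat U *\<^sub>v x = U *\<^sub>v (C *\<^sub>v ?y)"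
      using assms(2) C(1) UT UC x y by (simp add: assoc_mult_mat_vec[of _ v v _ v])
    moreover have "x \<bullet> (U *\<^sub>v (C *\<^sub>v ?y)) = ?y \<bullet> (C *\<^sub>v ?y)"
      using transpose_vec_mult_scalar[OF assms(2), of "C *\<^sub>v ?y" x] C(1) x y by simp
    ultimately show ?thesis using C(3)[OF y] by simp
  qed
  ultimately show ?thesis using assms(2) C(1) by (auto simp: nnd_mats_def)
qed

lemma smult_mult_mat_vec:
  fixes C :: "real mat"
  assumes "C \<in> carrier_mat n k" "y \<in> carrier_vec k"
  shows "(x \<cdot>\<^sub>m C) *\<^sub>v y = x \<cdot>\<^sub>v (C *\<^sub>v y)"
  using assms by (intro eq_vecI) (auto simp: scalar_prod_def sum_distrib_left mult.assoc)

lemma nnd_mats_convex: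
  assumes "C \<in> nnd_mats v" "D \<in> nnd_mats v" "0 \<le> x" "x \<le> 1"
  shows "x \<cdot>\<^sub>m C + (1 - x) \<cdot>\<^sub>m D \<in> nnd_mats v"
proof -
  have CD: "C \<in> carrier_mat v v" "D \<in> carrier_mat v v" "transpose_mat C = C" "transpose_mat D = D"
    using assms by (auto simp: nnd_mats_def)
  have "C $$ (j,i) = C $$ (i,j)" "D $$ (j,i) = D $$ (i,j)" if "i < v" "j < v" for i j
    using arg_cong[OF CD(3), of "\<lambda>M. M $$ (i,j)"] arg_cong[OF CD(4), of "\<lambda>M. M $$ (i,j)"] CD(1,2) that
    by auto
  then have "transpose_mat (x \<cdot>\<^sub>m C + (1 - x) \<cdot>\<^sub>m D) = x \<cdot>\<^sub>m C + (1 - x) \<cdot>\<^sub>m D"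
    using CD(1,2) by (intro eq_matI) auto
  moreover have "0 \<le> y \<bullet> ((x \<cdot>\<^sub>m C + (1 - x) \<cdot>\<^sub>m D) *\<^sub>v y)" if y: "y \<in> carrier_vec v" for y
  proof -
    have "(x \<cdot>\<^sub>m C + (1 - x) \<cdot>\<^sub>m D) *\<^sub>v y
        = x \<cdot>\<^sub>v (C *\<^sub>v y) + (1 - x) \<cdot>\<^sub>v (D *\<^sub>v y)"
      using CD y by (simp add: add_mult_distrib_mat_vec[of _ v v] smult_mult_mat_vec[of _ v v])
    then have "y \<bullet> ((x \<cdot>\<^sub>m C + (1 - x) \<cdot>\<^sub>m D) *\<^sub>v y) = x * (y \<bullet> (C *\<^sub>v y)) + (1 - x) * (y \<bullet> (D *\<^sub>v y))"
      using CD y by (simp add: scalar_prod_add_distrib[of _ v])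
    then show ?thesis using assms y by (simp add: nnd_mats_def)
  qed
  ultimately show ?thesis using CD by (simp add: nnd_mats_def)
qed

lemma criterion_convex_bound:
  assumes \<Phi>: "optimality_criterion v \<Phi>" and C: "C \<in> nnd_mats v" and D: "D \<in> nnd_mats v"
    and x: "0 < x" "x < 1" and le: "\<Phi> C \<le> M" "\<Phi> D \<le> M"
  shows "\<Phi> (x \<cdot>\<^sub>m C + (1 - x) \<cdot>\<^sub>m D) \<le> M"
proof (cases M)
  case (real r)
  have "\<Phi> (x \<cdot>\<^sub>m C + (1 - x) \<cdot>\<^sub>m D) \<le> ereal x * \<Phi> C + ereal (1 - x) * \<Phi> D"
    using \<Phi> C D x unfolding optimality_criterion_def by blast
  also have "\<dots> \<le> ereal x * M + ereal (1 - x) * M"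
    using x le by (intro add_mono ereal_mult_left_mono) auto
  also have "\<dots> = M" using real by (simp add: algebra_simps)
  finally show ?thesis .
next
  case MInf
  then show ?thesis using \<Phi> C le(1) unfolding optimality_criterion_def by auto
qed simp

text \<open>Signed permutation matrices are the only orthogonal matrices needed. Conjugation by one of them
permutes the indices and changes signs.\<close>

lemma criterion_signed_permutation:
  fixes \<sigma> :: "nat \<Rightarrow> real"
  assumes \<Phi>: "optimality_criterion v \<Phi>" and C: "C \<in> nnd_mats v"
    and \<pi>: "bij_betw \<pi> {..<v} {..<v}" and \<sigma>: "\<And>i. i < v \<Longrightarrow> \<sigma> i * \<sigma> i = 1"
  defines "D \<equiv> mat v v (\<lambda>(i,j). \<sigma> i * \<sigma> j * C $$ (\<pi> i, \<pi> j))"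
  shows "D \<in> nnd_mats v" "\<Phi> D = \<Phi> C"
proof -
  define U where "U = mat v v (\<lambda>(i,j). \<sigma> i * of_bool (\<pi> i = j))"
  have U: "U \<in> carrier_mat v v" and C': "C \<in> carrier_mat v v"
    using C by (auto simp: U_def nnd_mats_def)
  have \<pi>_less: "\<pi> i < v" if "i < v" for i
    using bij_betwE[OF \<pi>] that by auto
  have \<pi>_inj: "\<pi> i = \<pi> j \<longleftrightarrow> i = j" if "i < v" "j < v" for i j
    by (rule inj_on_eq_iff[OF bij_betw_imp_inj_on[OF \<pi>]]) (use that in simp_all)
  have pick: "(\<Sum>p<v. U $$ (i,p) * f p) = \<sigma> i * f (\<pi> i)" if "i < v" for i and f :: "nat \<Rightarrow> real"
  proof -
    have "(\<Sum>p<v. U $$ (i,p) * f p) = \<sigma> i * (\<Sum>p<v. f p * of_bool (\<pi> i = p))"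
      using that unfolding sum_distrib_left U_def by (intro sum.cong) auto
    then show ?thesis using sum_level_indicators[OF \<pi>_less[OF that]] by simp
  qed
  have "U * transpose_mat U = 1\<^sub>m v"
  proof (rule eq_matI)
    fix i j assume "i < dim_row (1\<^sub>m v :: real mat)" "j < dim_col (1\<^sub>m v :: real mat)"
    then have ij: "i < v" "j < v" by auto
    have "(U * transpose_mat U) $$ (i,j) = (\<Sum>p<v. U $$ (i,p) * U $$ (j,p))"
      using ij U by (simp add: scalar_prod_def lessThan_atLeast0)
    also have "\<dots> = \<sigma> i * U $$ (j, \<pi> i)" by (rule pick[OF ij(1)])
    also have "\<dots> = 1\<^sub>m v $$ (i,j)"
      using ij \<pi>_less \<pi>_inj \<sigma> by (auto simp: U_def)
    finally show "(U * transpose_mat U) $$ (i,j) = 1\<^sub>m v $$ (i,j)" .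
  qed (auto simp: U_def)
  moreover from this have "transpose_mat U * U = 1\<^sub>m v"
    using mat_mult_left_right_inverse U by (metis transpose_carrier_mat)
  ultimately have "\<Phi> (U * C * transpose_mat U) = \<Phi> C"
    using \<Phi> C U unfolding optimality_criterion_def by blast
  moreover have "U * C * transpose_mat U = D"
  proof (rule eq_matI)
    fix i j assume "i < dim_row D" "j < dim_col D"
    then have ij: "i < v" "j < v" by (auto simp: D_def)
    have "(U * C * transpose_mat U) $$ (i,j) = (\<Sum>p<v. \<Sum>q<v. U $$ (i,p) * U $$ (j,q) * C $$ (p,q))"
      by (rule bilinear_entry[OF U U C' ij])
    also have "\<dots> = (\<Sum>p<v. U $$ (i,p) * (\<Sum>q<v. U $$ (j,q) * C $$ (p,q)))"
      by (simp add: sum_distrib_left mult.assoc)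
    also have "\<dots> = D $$ (i,j)"
      using ij by (simp add: pick D_def)
    finally show "(U * C * transpose_mat U) $$ (i,j) = D $$ (i,j)" .
  qed (use U in \<open>auto simp: D_def\<close>)
  ultimately show "D \<in> nnd_mats v" "\<Phi> D = \<Phi> C"
    using nnd_mats_congruence[OF C U] by auto
qed

text \<open>Changing the sign of coordinate \<open>k\<close> and averaging with the original matrix removes the off-diagonal
entries of row and column \<open>k\<close>. Convexity and invariance show that this does not increase the
criterion; the coordinates are treated one after the other.\<close>

lemma criterion_diagonal_part_le:
  assumes \<Phi>: "optimality_criterion v \<Phi>" and C: "C \<in> nnd_mats v"
  defines "D \<equiv> mat v v (\<lambda>(i,j). if i = j then C $$ (i,i) else 0)"
  shows "D \<in> nnd_mats v" "\<Phi> D \<le> \<Phi> C"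
proof -
  define E where "E k = mat v v (\<lambda>(i,j). if i = j \<or> (k \<le> i \<and> k \<le> j) then C $$ (i,j) else 0)" for k
  have "E k \<in> nnd_mats v \<and> \<Phi> (E k) \<le> \<Phi> C" if "k \<le> v" for k
    using that
  proof (induction k)
    case 0
    have "E 0 = C" using C by (intro eq_matI) (auto simp: E_def nnd_mats_def)
    then show ?case using C by simp
  next
    case (Suc k)
    then have IH: "E k \<in> nnd_mats v" "\<Phi> (E k) \<le> \<Phi> C" by auto
    define \<sigma> where "\<sigma> i = (if i = k then -1 else 1 :: real)" for i
    define F where "F = mat v v (\<lambda>(i,j). \<sigma> i * \<sigma> j * E k $$ (id i, id j))"
    have F: "F \<in> nnd_mats v" "\<Phi> F = \<Phi> (E k)"
      unfolding F_def
      by (rule criterion_signed_permutation[OF \<Phi> IH(1) bij_betw_id]; simp add: \<sigma>_def)+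
    have "E (Suc k) = (1/2) \<cdot>\<^sub>m E k + (1 - 1/2) \<cdot>\<^sub>m F"
      by (intro eq_matI) (auto simp: E_def F_def \<sigma>_def)
    then show ?case
      using nnd_mats_convex[OF IH(1) F(1), of "1/2"]
        criterion_convex_bound[OF \<Phi> IH(1) F(1), of "1/2" "\<Phi> C"] IH F(2) by simp
  qed
  from this[of v] have "E v \<in> nnd_mats v" "\<Phi> (E v) \<le> \<Phi> C" by auto
  moreover have "E v = D" unfolding E_def D_def by (intro eq_matI) auto
  ultimately show "D \<in> nnd_mats v" "\<Phi> D \<le> \<Phi> C" by auto
qed

lemma bij_betw_rotate: "bij_betw (\<lambda>i. (i + k) mod v) {..<v} {..<v :: nat}"
proof -
  have "inj_on (\<lambda>i. (i + k) mod v) {..<v}"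
  proof (rule inj_onI)
    fix i j assume "i \<in> {..<v}" "j \<in> {..<v}" "(i + k) mod v = (j + k) mod v"
    then show "i = j"
      using cong_add_rcancel_nat[of i k j v] by (simp add: cong_def)
  qed
  moreover have "(\<lambda>i. (i + k) mod v) ` {..<v} \<subseteq> {..<v}" by auto
  ultimately show ?thesis
    by (simp add: bij_betw_def endo_inj_surj)
qed

text \<open>The mean of all \<open>v\<close> cyclic rotations of a diagonal matrix is a multiple of the identity. The mean is
formed by adding one rotation at a time, so that the two-point convexity of the criterion suffices.\<close>

lemma criterion_averaged_diagonal_le:
  fixes d :: "nat \<Rightarrow> real"
  assumes \<Phi>: "optimality_criterion v \<Phi>" and v: "0 < v"
    and D: "mat v v (\<lambda>(i,j). if i = j then d i else 0) \<in> nnd_mats v" (is "?D \<in> _")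
  shows "\<Phi> (((\<Sum>i<v. d i) / real v) \<cdot>\<^sub>m 1\<^sub>m v) \<le> \<Phi> ?D"
proof -
  define R where "R k = mat v v (\<lambda>(i,j). if i = j then d ((i + k) mod v) else 0)" for k
  have R: "R k \<in> nnd_mats v \<and> \<Phi> (R k) = \<Phi> ?D" for k
  proof -
    have inj: "(i + k) mod v = (j + k) mod v \<longleftrightarrow> i = j" if "i < v" "j < v" for i j
      by (rule inj_on_eq_iff[OF bij_betw_imp_inj_on[OF bij_betw_rotate]]) (use that in simp_all)
    have "R k = mat v v (\<lambda>(i,j). 1 * 1 * ?D $$ ((i + k) mod v, (j + k) mod v))"
      using v inj unfolding R_def by (intro eq_matI) auto
    then show ?thesis
      using criterion_signed_permutation[OF \<Phi> D bij_betw_rotate, of "\<lambda>_. 1" k] by simp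
  qed
  define S where "S n = mat v v (\<lambda>(i,j). if i = j then (\<Sum>k\<le>n. d ((i + k) mod v)) / real (Suc n) else 0)" for n
  have "S n \<in> nnd_mats v \<and> \<Phi> (S n) \<le> \<Phi> ?D" for n
  proof (induction n)
    case 0
    have "S 0 = R 0" unfolding S_def R_def by (intro eq_matI) auto
    then show ?case using R[of 0] by simp
  next
    case (Suc n)
    \<comment> \<open>the weight of the mean of \<open>n + 1\<close> rotations within the mean of \<open>n + 2\<close> rotations\<close>
    define x where "x = real (Suc n) / real (Suc (Suc n))"
    have x: "0 < x" "x < 1" by (simp_all add: x_def)
    have mean: "(a + b) / real (Suc (Suc n)) = x * (a / real (Suc n)) + (1 - x) * b" for a b
    proof -
      have "x * (a / real (Suc n)) = a / real (Suc (Suc n))" "1 - x = 1 / real (Suc (Suc n))"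
        by (simp_all add: x_def divide_simps)
      then show ?thesis by (simp add: add_divide_distrib)
    qed
    have "S (Suc n) = x \<cdot>\<^sub>m S n + (1 - x) \<cdot>\<^sub>m R (Suc n)"
      unfolding S_def R_def by (intro eq_matI) (auto simp: mean simp del: of_nat_Suc)
    then show ?case
      using nnd_mats_convex[of "S n" v "R (Suc n)" x] R[of "Suc n"] Suc x
        criterion_convex_bound[OF \<Phi>, of "S n" "R (Suc n)" x "\<Phi> ?D"] by simp
  qed
  then have "\<Phi> (S (v - 1)) \<le> \<Phi> ?D" by blast
  moreover have "S (v - 1) = ((\<Sum>i<v. d i) / real v) \<cdot>\<^sub>m 1\<^sub>m v"
  proof (rule eq_matI)
    have "(\<Sum>k\<le>v - 1. d ((i + k) mod v)) = (\<Sum>i<v. d i)" for i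
    proof -
      have "{..v - 1} = {..<v}" using v by auto
      then have "(\<Sum>k\<le>v - 1. d ((i + k) mod v)) = (\<Sum>k<v. d ((k + i) mod v))"
        by (simp add: add.commute)
      also have "\<dots> = (\<Sum>i<v. d i)"
        by (rule sum.reindex_bij_betw[OF bij_betw_rotate])
      finally show ?thesis .
    qed
    then show "S (v - 1) $$ (i,j) = (((\<Sum>i<v. d i) / real v) \<cdot>\<^sub>m 1\<^sub>m v) $$ (i,j)"
      if "i < dim_row (((\<Sum>i<v. d i) / real v) \<cdot>\<^sub>m 1\<^sub>m v)" "j < dim_col (((\<Sum>i<v. d i) / real v) \<cdot>\<^sub>m 1\<^sub>m v)" for i j
      using that v by (simp add: S_def)
  qed (simp_all add: S_def)
  ultimately show ?thesis by simp
qed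

text \<open>Kiefer's sufficient condition for universal optimality: a multiple of the identity is best among
all matrices whose trace is positive and does not exceed its own. A positive trace is
essential, since monotonicity in the scale factor says nothing about the zero matrix.\<close>

lemma criterion_scalar_matrix_le:
  assumes \<Phi>: "optimality_criterion v \<Phi>" and C: "C \<in> nnd_mats v"
    and pos: "0 < (\<Sum>i<v. C $$ (i,i))" and le: "(\<Sum>i<v. C $$ (i,i)) \<le> real v * a"
  shows "\<Phi> (a \<cdot>\<^sub>m 1\<^sub>m v) \<le> \<Phi> C"
proof -
  let ?m = "(\<Sum>i<v. C $$ (i,i)) / real v"
  have v: "0 < v" using pos by (cases v) auto
  have I: "1\<^sub>m v \<in> nnd_mats v"
  proof -
    have "0 \<le> x \<bullet> (1\<^sub>m v *\<^sub>v x)" if "x \<in> carrier_vec v" for x :: "real vec"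
      unfolding one_mult_mat_vec[OF that] by (simp add: scalar_prod_def sum_nonneg)
    then show ?thesis by (simp add: nnd_mats_def)
  qed
  have "\<Phi> (a \<cdot>\<^sub>m 1\<^sub>m v) \<le> \<Phi> (?m \<cdot>\<^sub>m 1\<^sub>m v)"
    using \<Phi> I pos le v unfolding optimality_criterion_def by (auto simp: field_simps)
  also have "\<dots> \<le> \<Phi> (mat v v (\<lambda>(i,j). if i = j then C $$ (i,i) else 0))"
    by (rule criterion_averaged_diagonal_le[OF \<Phi> v criterion_diagonal_part_le(1)[OF \<Phi> C]])
  also have "\<dots> \<le> \<Phi> C"
    by (rule criterion_diagonal_part_le(2)[OF \<Phi> C])
  finally show ?thesis .
qed

section \<open>Plans with information matrices \<open>w (s I - J)\<close>\<close>

text \<open>The matrices \<open>w (s I - J)\<close> are the multiples of the projection onto the contrasts, so that any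
orthonormal basis of contrasts turns them into \<open>w s I\<close>.\<close>

lemma equal_info_C_mat:
  assumes P: "blocked_plan s t b P" and H: "\<forall>A<t. contrast_mat s (H A)"
    and info: "\<And>A B p q. A < t \<Longrightarrow> B < t \<Longrightarrow> p < s \<Longrightarrow> q < s \<Longrightarrow>
      info P A B p q = (if A = B then w * (real s * of_bool (p = q) - 1) else 0)"
  shows "C_mat s t b H P = (w * real s) \<cdot>\<^sub>m 1\<^sub>m (t * (s-1))"
proof (rule eq_matI)
  let ?v = "t * (s-1)"
  fix i j assume "i < dim_row ((w * real s) \<cdot>\<^sub>m 1\<^sub>m ?v)" "j < dim_col ((w * real s) \<cdot>\<^sub>m 1\<^sub>m ?v)"
  then have ij: "i < ?v" "j < ?v" by auto
  have blk: "\<forall>u<runs P. blk P u < b" using P by (simp add: blocked_plan_def)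
  let ?A = "i div (s-1)" and ?B = "j div (s-1)" and ?k = "i mod (s-1)" and ?l = "j mod (s-1)"
  have AB: "?A < t" "?B < t" using ij less_mult_imp_div_less by blast+
  have "0 < s - 1" using ij(1) by (cases "s - 1") auto
  then have kl: "?k < s - 1" "?l < s - 1" by auto
  have "C_mat s t b H P $$ (i,j) = (\<Sum>p<s. \<Sum>q<s. H ?A $$ (?k,p) * H ?B $$ (?l,q) * info P ?A ?B p q)"
    by (rule C_mat_entry[OF blk H ij])
  also have "\<dots> = w * real s * of_bool (i = j)"
  proof (cases "?A = ?B")
    case True
    let ?x = "\<lambda>p. H ?A $$ (?k,p)" and ?y = "\<lambda>q. H ?A $$ (?l,q)"
    have "(\<Sum>p<s. \<Sum>q<s. H ?A $$ (?k,p) * H ?B $$ (?l,q) * info P ?A ?B p q)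
        = (\<Sum>p<s. w * real s * ?x p * (\<Sum>q<s. ?y q * of_bool (p = q)) - w * ?x p * (\<Sum>q<s. ?y q))"
      unfolding sum_distrib_left sum_subtractf[symmetric] True[symmetric]
      by (intro sum.cong[OF refl]) (simp add: info[OF AB(1) AB(1)] algebra_simps del: One_nat_def)
    also have "\<dots> = (\<Sum>p<s. w * real s * (?x p * ?y p))"
      using H AB kl by (intro sum.cong[OF refl])
        (simp add: sum_level_indicators contrast_mat_row_sum del: sum_mult_of_bool_eq)
    also have "\<dots> = w * real s * of_bool (?k = ?l)"
      using H AB kl by (simp add: sum_distrib_left[symmetric] contrast_mat_rows_orthonormal)
    also have "(?k = ?l) = (i = j)"
      using True by (metis div_mult_mod_eq)
    finally show ?thesis .
  next
    case False
    then show ?thesis using info[OF AB] by auto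
  qed
  finally show "C_mat s t b H P $$ (i,j) = ((w * real s) \<cdot>\<^sub>m 1\<^sub>m ?v) $$ (i,j)"
    using ij by simp
qed (simp_all add: C_mat_def)

text \<open>The weights that estimate a contrast \<open>c\<close> of factor \<open>A\<close> are the block-centred values of \<open>c\<close> at the
runs, divided by \<open>w s\<close>. Centring removes the block effects, orthogonality through the blocks
removes the other factors, and on \<open>A\<close> itself the matrix \<open>s I - J\<close> acts on \<open>c\<close> as multiplication
by \<open>s\<close>.\<close>

lemma equal_info_connected:
  assumes P: "blocked_plan s t b P" and w: "0 < w"
    and info: "\<And>A B p q. A < t \<Longrightarrow> B < t \<Longrightarrow> p < s \<Longrightarrow> q < s \<Longrightarrow>
      info P A B p q = (if A = B then w * (real s * of_bool (p = q) - 1) else 0)"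
  shows "connected_plan s t P"
  unfolding connected_plan_def
proof (intro allI impI)
  fix A and c :: "nat \<Rightarrow> real" assume A: "A < t" and c: "(\<Sum>p<s. c p) = 0"
  have lev: "\<And>B. B < t \<Longrightarrow> \<forall>u<runs P. lev P B u < s"
    using P by (auto simp: blocked_plan_def)
  let ?f = "\<lambda>u. c (lev P A u)"
  define e where "e u = ?f u - block_mean P ?f (blk P u)" for u
  have "(\<Sum>u<runs P. e u * (\<beta> (blk P u) + (\<Sum>B<t. \<tau> B (lev P B u)))) = w * real s * (\<Sum>p<s. c p * \<tau> A p)"
    for \<beta> :: "nat \<Rightarrow> real" and \<tau> :: "nat \<Rightarrow> nat \<Rightarrow> real"
  proof -
    have "(\<Sum>u<runs P. e u * \<beta> (blk P u)) = 0"
      unfolding e_def by (rule sum_centred_times_block_function)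
    then have "(\<Sum>u<runs P. e u * (\<beta> (blk P u) + (\<Sum>B<t. \<tau> B (lev P B u))))
        = within_block_product P ?f (\<lambda>u. \<Sum>B<t. 1 * \<tau> B (lev P B u))"
      by (simp add: within_block_product_left e_def distrib_left sum.distrib)
    also have "\<dots> = (\<Sum>B<t. within_block_product P ?f (\<lambda>u. \<tau> B (lev P B u)))"
      unfolding within_block_product_sum_right by simp
    also have "\<dots> = (\<Sum>B<t. \<Sum>p<s. \<Sum>q<s. c p * \<tau> B q * info P A B p q)"
      using A lev by (intro sum.cong[OF refl] within_block_product_levels) auto
    also have "\<dots> = (\<Sum>B<t. if B = A then w * real s * (\<Sum>p<s. c p * \<tau> A p) else 0)"
    proof (rule sum.cong[OF refl])
      fix B assume "B \<in> {..<t}"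
      then have B: "B < t" by simp
      show "(\<Sum>p<s. \<Sum>q<s. c p * \<tau> B q * info P A B p q)
          = (if B = A then w * real s * (\<Sum>p<s. c p * \<tau> A p) else 0)"
      proof (cases "B = A")
        case True
        have "(\<Sum>p<s. \<Sum>q<s. c p * \<tau> B q * info P A B p q)
            = (\<Sum>p<s. w * real s * c p * (\<Sum>q<s. \<tau> A q * of_bool (p = q)) - c p * (w * (\<Sum>q<s. \<tau> A q)))"
          unfolding sum_distrib_left sum_subtractf[symmetric] True
          by (intro sum.cong[OF refl]) (simp add: info[OF A A] algebra_simps)
        also have "\<dots> = (\<Sum>p<s. w * real s * (c p * \<tau> A p) - c p * (w * (\<Sum>q<s. \<tau> A q)))"
          by (intro sum.cong[OF refl]) (simp add: sum_level_indicators del: sum_mult_of_bool_eq)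
        also have "\<dots> = w * real s * (\<Sum>p<s. c p * \<tau> A p)"
          unfolding sum_subtractf sum_distrib_left[symmetric] sum_distrib_right[symmetric] c by simp
        finally show ?thesis using True by simp
      next
        case False
        then show ?thesis using info[OF A B] by auto
      qed
    qed
    finally show ?thesis using A by simp
  qed
  note est = this
  show "estimable s t P A c"
  proof (cases "s = 0")
    case True
    then show ?thesis unfolding estimable_def by (intro exI[of _ "\<lambda>_. 0"]) simp
  next
    case False
    with w have ws: "w * real s \<noteq> 0" by simp
    show ?thesis unfolding estimable_def
    proof (intro exI allI)
      fix \<beta> :: "nat \<Rightarrow> real" and \<tau> :: "nat \<Rightarrow> nat \<Rightarrow> real"
      show "(\<Sum>u<runs P. e u / (w * real s) * (\<beta> (blk P u) + (\<Sum>B<t. \<tau> B (lev P B u)))) = (\<Sum>p<s. c p * \<tau> A p)"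
        using est[of \<beta> \<tau>] ws by (simp add: sum_divide_distrib[symmetric])
    qed
  qed
qed

section \<open>Copies of a plan\<close>

text \<open>In this and the next lemmas \<open>P\<close> consists of \<open>N\<close> copies of the block structure of \<open>B\<close>, with the
runs and the blocks of copy \<open>c\<close> numbered after those of the copies before it. The levels in the
copies may differ.\<close>

lemma replicated_block:
  fixes r b c i N :: nat and P B :: plan
  assumes "runs B = r" "runs P = N * r"
    and B: "\<forall>u<r. blk B u < b"
    and P: "\<forall>d<N. \<forall>u<r. blk P (d * r + u) = d * b + blk B u"
    and c: "c < N" "i < b"
  shows "{u. u < runs P \<and> blk P u = c * b + i} = (\<lambda>u. c * r + u) ` {u. u < runs B \<and> blk B u = i}"
proof (intro Set.set_eqI iffI)
  fix u assume u: "u \<in> {u. u < runs P \<and> blk P u = c * b + i}"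
  then have "u < N * r" using assms(2) by simp
  then have d: "u div r < N" and "r \<noteq> 0"
    by (auto intro: less_mult_imp_div_less intro!: gr0I)
  then have m: "u mod r < r" by simp
  have "blk P (u div r * r + u mod r) = u div r * b + blk B (u mod r)"
    using P d m by blast
  then have eq: "u div r * b + blk B (u mod r) = c * b + i"
    using u by simp
  have "blk B (u mod r) < b" using B m by blast
  then have "(u div r * b + blk B (u mod r)) div b = u div r"
    by simp
  moreover have "(c * b + i) div b = c" using c by simp
  ultimately have "u div r = c" using eq by simp
  moreover from this have "blk B (u mod r) = i" using eq by simp
  ultimately show "u \<in> (\<lambda>u. c * r + u) ` {u. u < runs B \<and> blk B u = i}"
    using m assms(1) by (intro image_eqI[of _ _ "u mod r"]) auto
next
  fix u assume "u \<in> (\<lambda>u. c * r + u) ` {u. u < runs B \<and> blk B u = i}"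
  then obtain x where x: "u = c * r + x" "x < r" "blk B x = i" using assms(1) by auto
  have "u < Suc c * r" using x by simp
  also have "\<dots> \<le> N * r" using c by (intro mult_right_mono) auto
  finally show "u \<in> {u. u < runs P \<and> blk P u = c * b + i}"
    using x P c(1) assms(2) by simp
qed

lemma sum_product_index:
  fixes f :: "nat \<Rightarrow> 'a::comm_monoid_add"
  shows "(\<Sum>u<N * r. f u) = (\<Sum>c<N. \<Sum>u<r. f (c * r + u))"
proof -
  have "(\<Sum>u = c * r..<c * r + r. f u) = (\<Sum>u<r. f (c * r + u))" for c
    using sum.shift_bounds_nat_ivl[of f 0 "c * r" r] by (simp add: lessThan_atLeast0 add.commute)
  then show ?thesis by (simp flip: sum.nat_group)
qed

text \<open>Blocks never meet two copies, so the copies contribute separately.\<close>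

lemma replicated_within_block_product:
  fixes r b N :: nat
  assumes "runs B = r" "runs P = N * r"
    and B: "\<forall>u<r. blk B u < b"
    and P: "\<forall>d<N. \<forall>u<r. blk P (d * r + u) = d * b + blk B u"
  shows "within_block_product P f g =
    (\<Sum>c<N. within_block_product B (\<lambda>u. f (c * r + u)) (\<lambda>u. g (c * r + u)))"
proof -
  have mean: "block_mean P h (c * b + i) = block_mean B (\<lambda>u. h (c * r + u)) i" if "c < N" "i < b" for h c i
    unfolding block_mean_def block_size_def replicated_block[OF assms that]
    by (simp add: sum.reindex card_image inj_on_def)
  show ?thesis
    unfolding within_block_product_def assms(2) sum_product_index
    using assms(1) by (intro sum.cong[OF refl]) (simp add: P B mean)
qed

lemma replicated_block_size:
  fixes r b N :: nat
  assumes "runs B = r" "runs P = N * r"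
    and "\<forall>u<r. blk B u < b"
    and "\<forall>d<N. \<forall>u<r. blk P (d * r + u) = d * b + blk B u"
    and "c < N" "i < b"
  shows "block_size P (c * b + i) = block_size B i"
  unfolding block_size_def replicated_block[OF assms] by (simp add: card_image inj_on_def)

section \<open>A plan for three factors in three blocks\<close>

text \<open>The case \<open>m = N = 1\<close>: the columns of the three level lists form the blocks \<open>000, 012, 120, 201\<close> and
\<open>000, 021, 102, 210\<close> and \<open>111, 222\<close>. The six permutations of \<open>0, 1, 2\<close> contain each ordered pair of
distinct levels once in any two factors, and the other four runs supply the pairs of equal levels,
with \<open>00\<close> occurring twice. Each factor has level 0 twice in each large block and never in the small
one.\<close>

definition cell_plan :: plan where
  "cell_plan = \<lparr>runs = 10,
     blk = (\<lambda>u. [0,0,0,0, 1,1,1,1, 2,2] ! u),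
     lev = (\<lambda>A u. [[0,0,1,2, 0,0,1,2, 1,2],
                   [0,1,2,0, 0,2,0,1, 1,2],
                   [0,2,0,1, 0,1,2,0, 1,2]] ! A ! u)\<rparr>"

lemma lessThan_3: "{..<3::nat} = {0,1,2}" by auto

lemma cell_plan_runs: "runs cell_plan = 10"
  by (simp add: cell_plan_def)

lemma cell_plan_range:
  assumes "u < 10"
  shows "blk cell_plan u < 3" "A < 3 \<Longrightarrow> lev cell_plan A u < 3"
proof -
  have u: "u \<in> {0,1,2,3,4,5,6,7,8,9}" using assms by auto
  then show "blk cell_plan u < 3" by (auto simp: cell_plan_def)
  assume "A < 3"
  then have "A \<in> {0,1,2}" by auto
  then show "lev cell_plan A u < 3" using u by (auto simp: cell_plan_def)
qed

lemma lessThan_runs_cell_plan: "{..<runs cell_plan} = {0,1,2,3,4,5,6,7,8,9}"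
  by (auto simp: cell_plan_runs)

lemma cell_plan_blk_less: "\<forall>u<runs cell_plan. blk cell_plan u < 3"
  by (simp add: cell_plan_range cell_plan_runs)

lemma cell_plan_blocks:
  "{u. u < runs cell_plan \<and> blk cell_plan u = 0} = {0,1,2,3}"
  "{u. u < runs cell_plan \<and> blk cell_plan u = 1} = {4,5,6,7}"
  "{u. u < runs cell_plan \<and> blk cell_plan u = 2} = {8,9}"
proof -
  have *: "{u. u < runs cell_plan \<and> blk cell_plan u = j} = Set.filter (\<lambda>u. blk cell_plan u = j) {0,1,2,3,4,5,6,7,8,9}" for j
    by (auto simp: cell_plan_runs)
  show "{u. u < runs cell_plan \<and> blk cell_plan u = 0} = {0,1,2,3}"
  "{u. u < runs cell_plan \<and> blk cell_plan u = 1} = {4,5,6,7}"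
  "{u. u < runs cell_plan \<and> blk cell_plan u = 2} = {8,9}"
    unfolding * by (auto simp: cell_plan_def)
qed

lemma cell_plan_block_size:
  "block_size cell_plan 0 = 4" "block_size cell_plan 1 = 4" "block_size cell_plan 2 = 2"
  unfolding block_size_def cell_plan_blocks by simp_all

text \<open>Every factor has the level frequencies \<open>2, 1, 1\<close> in both large blocks and \<open>0, 1, 1\<close> in the small
one, so \<open>L D L'\<close> is the same matrix for all pairs of factors, with entry 2 in position \<open>(0,0)\<close> and 1
elsewhere. For distinct factors these are also the pair frequencies; for equal factors the
frequencies \<open>4, 3, 3\<close> of the levels on the diagonal leave \<open>3 I - J\<close>.\<close>

lemma cell_plan_info:
  assumes "A < 3" "B < 3" "p < 3" "q < 3"
  shows "info cell_plan A B p q = (if A = B then 3 * of_bool (p = q) - 1 else 0)"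
proof -
  \<comment> \<open>evaluated once, for use in all 81 cases below\<close>
  have levels:
    "map (lev cell_plan 0) [0,1,2,3,4,5,6,7,8,9] = [0,0,1,2, 0,0,1,2, 1,2]"
    "map (lev cell_plan 1) [0,1,2,3,4,5,6,7,8,9] = [0,1,2,0, 0,2,0,1, 1,2]"
    "map (lev cell_plan 2) [0,1,2,3,4,5,6,7,8,9] = [0,2,0,1, 0,1,2,0, 1,2]"
    by (simp_all add: cell_plan_def)
  let ?f = "\<lambda>u. of_bool (lev cell_plan A u = p) :: real" and ?g = "\<lambda>u. of_bool (lev cell_plan B u = q) :: real"
  have "info cell_plan A B p q =
     (\<Sum>u\<in>{0,1,2,3,4,5,6,7,8,9}. ?f u * ?g u)
     - (\<Sum>u\<in>{0,1,2,3}. ?f u) * (\<Sum>u\<in>{0,1,2,3}. ?g u) / 4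
     - (\<Sum>u\<in>{4,5,6,7}. ?f u) * (\<Sum>u\<in>{4,5,6,7}. ?g u) / 4
     - (\<Sum>u\<in>{8,9}. ?f u) * (\<Sum>u\<in>{8,9}. ?g u) / 2"
    unfolding info_def
    by (simp add: within_block_product_explicit[where b = 3, OF cell_plan_blk_less] lessThan_3
        cell_plan_blocks cell_plan_block_size lessThan_runs_cell_plan
        del: One_nat_def sum_of_bool_eq sum_mult_of_bool_eq sum_of_bool_mult_eq)
  moreover have "A \<in> {0,1,2}" "B \<in> {0,1,2}" "p \<in> {0,1,2}" "q \<in> {0,1,2}"
    using assms by auto
  ultimately show ?thesis
    by (elim insertE emptyE; simp add: levels[simplified])
qed

section \<open>Copies shifted by an orthogonal array\<close>

text \<open>The orthogonal array has only \<open>m - 1\<close> rows; the first of the \<open>m\<close> groups of factors is not shifted.\<close>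

definition row_shift :: "nat mat \<Rightarrow> nat \<Rightarrow> nat \<Rightarrow> nat" where
  "row_shift X g c = (case g of 0 \<Rightarrow> 0 | Suc h \<Rightarrow> X $$ (h,c))"

text \<open>Factor \<open>A\<close> belongs to group \<open>A div 3\<close> and plays the role of factor \<open>A mod 3\<close> of the cell. Column \<open>c\<close>
of the array gives the cyclic shifts of the levels in copy \<open>c\<close> of the cell, one for each group.\<close>

definition shifted_cells_plan :: "nat \<Rightarrow> nat mat \<Rightarrow> plan" where
  "shifted_cells_plan N X = \<lparr>runs = N * 10,
     blk = (\<lambda>u. u div 10 * 3 + blk cell_plan (u mod 10)),
     lev = (\<lambda>A u. (lev cell_plan (A mod 3) (u mod 10) + row_shift X (A div 3) (u div 10)) mod 3)\<rparr>"

lemma shifted_cells_replicate: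
  "runs (shifted_cells_plan N X) = N * 10"
  "\<forall>u<10. blk cell_plan u < 3"
  "\<forall>c<N. \<forall>u<10. blk (shifted_cells_plan N X) (c * 10 + u) = c * 3 + blk cell_plan u"
  by (auto simp: shifted_cells_plan_def cell_plan_range)

lemma shifted_cells_lev:
  "u < 10 \<Longrightarrow> lev (shifted_cells_plan N X) A (c * 10 + u) =
     (lev cell_plan (A mod 3) u + row_shift X (A div 3) c) mod 3"
  by (simp add: shifted_cells_plan_def)

lemma shifted_cells_block_size:
  assumes "c < N" "i < 3"
  shows "block_size (shifted_cells_plan N X) (c * 3 + i) = block_size cell_plan i"
  by (rule replicated_block_size[OF cell_plan_runs shifted_cells_replicate assms])

lemma shifted_cells_on_setup:
  "shifted_cells_plan N X \<in> plans_on_setup m N"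
proof -
  let ?P = "shifted_cells_plan N X"
  have count: "card {j. j < 3 * N \<and> block_size ?P j = k} = N * card {i. i < 3 \<and> block_size cell_plan i = k}" for k
  proof -
    have "real (card {j. j < 3 * N \<and> block_size ?P j = k}) = (\<Sum>j<N*3. of_bool (block_size ?P j = k))"
      by (simp only: card_eq_sum_of_bool mult.commute)
    also have "\<dots> = (\<Sum>c<N. \<Sum>i<3. of_bool (block_size cell_plan i = k))"
      unfolding sum_product_index by (intro sum.cong[OF refl]) (simp add: shifted_cells_block_size)
    also have "\<dots> = real (N * card {i. i < 3 \<and> block_size cell_plan i = k})"
      by (simp only: card_eq_sum_of_bool of_nat_mult) simp
    finally show ?thesis by (simp only: of_nat_eq_iff)
  qed
  have three: "i = 0 \<or> i = 1 \<or> i = 2" if "i < 3" for i :: nat using that by auto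
  have "{i. i < 3 \<and> block_size cell_plan i = 4} = {0,1}" "{i. i < 3 \<and> block_size cell_plan i = 2} = {2}"
    using cell_plan_block_size by (auto dest!: three)
  moreover have "0 < block_size ?P j" if "j < 3 * N" for j
  proof -
    have "j div 3 < N" using that by auto
    then have "block_size ?P j = block_size cell_plan (j mod 3)"
      using shifted_cells_block_size[of "j div 3" N "j mod 3" X] by simp
    then show ?thesis
      using cell_plan_block_size three[of "j mod 3"] by auto
  qed
  moreover have "blk ?P u < 3 * N" "lev ?P A u < 3" if "u < runs ?P" for u A
  proof -
    have u: "u div 10 < N" using that by (auto simp: shifted_cells_plan_def)
    have "blk ?P u < u div 10 * 3 + 3"
      using cell_plan_range(1)[of "u mod 10"] by (simp add: shifted_cells_plan_def)
    also have "\<dots> \<le> 3 * N" using u by simp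
    finally show "blk ?P u < 3 * N" .
    show "lev ?P A u < 3" by (simp add: shifted_cells_plan_def)
  qed
  ultimately show ?thesis
    by (simp add: plans_on_setup_def blocked_plan_def count)
qed

text \<open>Adding \<open>2 * x\<close> undoes a shift by \<open>x\<close>, which avoids subtraction on natural numbers.\<close>

lemma shift_mod_3_eq_iff:
  fixes l x p :: nat
  assumes "l < 3" "p < 3"
  shows "(l + x) mod 3 = p \<longleftrightarrow> l = (p + 2 * x) mod 3"
proof -
  have "l \<in> {0,1,2}" "p \<in> {0,1,2}" using assms by auto
  then show ?thesis by (elim insertE emptyE; simp; presburger)
qed

lemma shifted_cells_info:
  assumes "p < 3" "q < 3"
  shows "info (shifted_cells_plan N X) A B p q =
    (\<Sum>c<N. if A mod 3 = B mod 3
       then 3 * of_bool ((p + 2 * row_shift X (A div 3) c) mod 3 = (q + 2 * row_shift X (B div 3) c) mod 3) - 1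
       else 0)"
proof -
  have "info (shifted_cells_plan N X) A B p q =
    (\<Sum>c<N. info cell_plan (A mod 3) (B mod 3) ((p + 2 * row_shift X (A div 3) c) mod 3)
               ((q + 2 * row_shift X (B div 3) c) mod 3))"
    unfolding info_def replicated_within_block_product[OF cell_plan_runs shifted_cells_replicate]
    using assms
    by (intro sum.cong[OF refl] within_block_product_cong)
       (simp_all add: shifted_cells_lev cell_plan_runs shift_mod_3_eq_iff cell_plan_range)
  then show ?thesis by (simp add: cell_plan_info)
qed

text \<open>This is where the array enters: for a fixed value of \<open>x\<close>, the shift \<open>y\<close> takes its three values
equally often, and over three consecutive shifts the matrix \<open>3 I - J\<close> sums to zero in each row.\<close>

lemma balanced_shifts_cancel:
  fixes x y :: "nat \<Rightarrow> nat"
  assumes x: "\<And>c. c < N \<Longrightarrow> x c < 3" and y: "\<And>c. c < N \<Longrightarrow> y c < 3"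
    and bal: "\<And>a. a < 3 \<Longrightarrow> \<exists>l. \<forall>b<3. card {c. c < N \<and> x c = a \<and> y c = b} = l"
    and pq: "p < 3" "q < 3"
  shows "(\<Sum>c<N. 3 * of_bool ((p + 2 * x c) mod 3 = (q + 2 * y c) mod 3) - 1 :: real) = 0"
proof -
  define F where "F a b = (3 * of_bool ((p + 2 * a) mod 3 = (q + 2 * b) mod 3) - 1 :: real)" for a b :: nat
  have F0: "(\<Sum>b<3. F a b) = 0" if "a < 3" for a
  proof -
    have "a \<in> {0,1,2}" "p \<in> {0,1,2}" "q \<in> {0,1,2}" using that pq by auto
    then show ?thesis unfolding lessThan_3 F_def by (elim insertE emptyE; simp)
  qed
  have "(\<Sum>c<N. F (x c) (y c)) = (\<Sum>c<N. \<Sum>a<3. \<Sum>b<3. F a b * of_bool (x c = a \<and> y c = b))"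
  proof (rule sum.cong[OF refl])
    fix c assume "c \<in> {..<N}"
    then have "x c < 3" "y c < 3" using x y by auto
    have "(\<Sum>a<3. \<Sum>b<3. F a b * of_bool (x c = a \<and> y c = b))
        = (\<Sum>a<3. (\<Sum>b<3. F a b * of_bool (y c = b)) * of_bool (x c = a))"
      unfolding sum_distrib_right by (intro sum.cong[OF refl]) auto
    also have "\<dots> = (\<Sum>b<3. F (x c) b * of_bool (y c = b))"
      by (rule sum_level_indicators) fact
    also have "\<dots> = F (x c) (y c)"
      by (rule sum_level_indicators) fact
    finally show "F (x c) (y c) = (\<Sum>a<3. \<Sum>b<3. F a b * of_bool (x c = a \<and> y c = b))" by simp
  qed
  also have "\<dots> = (\<Sum>a<3. \<Sum>c<N. \<Sum>b<3. F a b * of_bool (x c = a \<and> y c = b))"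
    by (rule sum.swap)
  also have "\<dots> = (\<Sum>a<3. \<Sum>b<3. \<Sum>c<N. F a b * of_bool (x c = a \<and> y c = b))"
    by (intro sum.cong[OF refl] sum.swap)
  also have "\<dots> = (\<Sum>a<3. \<Sum>b<3. F a b * real (card {c. c < N \<and> x c = a \<and> y c = b}))"
    unfolding card_eq_sum_of_bool sum_distrib_left ..
  also have "\<dots> = 0"
  proof (rule sum.neutral, rule ballI)
    fix a :: nat assume "a \<in> {..<3}"
    then have a: "a < 3" by simp
    obtain l where l: "\<forall>b<3. card {c. c < N \<and> x c = a \<and> y c = b} = l" using bal[OF a] by blast
    have "(\<Sum>b<3. F a b * real (card {c. c < N \<and> x c = a \<and> y c = b})) = (\<Sum>b<3. F a b * real l)"
      using l by (intro sum.cong[OF refl]) auto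
    then show "(\<Sum>b<3. F a b * real (card {c. c < N \<and> x c = a \<and> y c = b})) = 0"
      using F0[OF a] by (simp flip: sum_distrib_right)
  qed
  finally show ?thesis unfolding F_def .
qed

text \<open>Distinct factors in the roles of distinct factors of the cell are orthogonal within every copy.
Within one group the shifts are equal and \<open>3 I - J\<close> does not change under a common shift, so that
a factor with itself gives \<open>N\<close> times this matrix. Factors of the same role in different groups are
orthogonal by \<open>balanced_shifts_cancel\<close>.\<close>

lemma shifted_cells_equal_info:
  assumes X: "is_OA N (m - 1) 3 X" and A: "A < 3 * m" and B: "B < 3 * m" and p: "p < 3" and q: "q < 3"
  shows "info (shifted_cells_plan N X) A B p q =
    (if A = B then real N * (real 3 * of_bool (p = q) - 1) else 0)"
proof -
  let ?x = "row_shift X (A div 3)" and ?y = "row_shift X (B div 3)"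
  have lt: "row_shift X g c < 3" if "g < m" "c < N" for g c
    using X that by (cases g) (auto simp: row_shift_def is_OA_def)
  have AB: "A div 3 < m" "B div 3 < m" using A B by auto
  show ?thesis
  proof (cases "A mod 3 = B mod 3")
    case False
    then show ?thesis using shifted_cells_info[OF p q] by auto
  next
    case mods: True
    show ?thesis
    proof (cases "A div 3 = B div 3")
      case True
      then have "A = B" using mods by (metis div_mult_mod_eq)
      moreover have "(p + 2 * r) mod 3 = (q + 2 * r) mod 3 \<longleftrightarrow> p = q" for r
        using cong_add_rcancel_nat[of p "2 * r" q 3] p q by (simp add: cong_def)
      ultimately show ?thesis using shifted_cells_info[OF p q] by simp
    next
      case False
      then have "A \<noteq> B" by auto
      have cancel: "(\<Sum>c<N. 3 * of_bool ((p' + 2 * row_shift X g c) mod 3 = (q' + 2 * row_shift X (Suc h) c) mod 3) - 1 :: real) = 0"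
        if "g < m" "Suc h < m" "g \<noteq> Suc h" "p' < 3" "q' < 3" for g h p' q'
      proof (rule balanced_shifts_cancel)
        fix a :: nat assume a: "a < 3"
        show "\<exists>l. \<forall>b<3. card {c. c < N \<and> row_shift X g c = a \<and> row_shift X (Suc h) c = b} = l"
        \<comment> \<open>an unshifted group only needs the balance of a single row of the array, two shifted groups that of a pair of rows\<close>
        proof (cases g)
          case 0
          have "h < m - 1" using that by simp
          then obtain l where "\<forall>b<3. card {c. c < N \<and> X $$ (h,c) = b} = l"
            using X unfolding is_OA_def by blast
          then show ?thesis using 0 by (cases "a = 0") (auto simp: row_shift_def)
        next
          case (Suc k)
          then have "k < m - 1" "h < m - 1" "k \<noteq> h" using that by auto
          then obtain l where "\<forall>a<3. \<forall>b<3. card {c. c < N \<and> X $$ (k,c) = a \<and> X $$ (h,c) = b} = l"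
            using X unfolding is_OA_def by blast
          then show ?thesis using Suc a by (auto simp: row_shift_def)
        qed
      qed (use that lt in auto)
      have "(\<Sum>c<N. 3 * of_bool ((p + 2 * ?x c) mod 3 = (q + 2 * ?y c) mod 3) - 1 :: real) = 0"
      proof (cases "B div 3")
        case (Suc h)
        then show ?thesis using cancel[of "A div 3" h p q] AB False p q by simp
      next
        case 0
        then obtain h where h: "A div 3 = Suc h" using False by (cases "A div 3") auto
        then have "(\<Sum>c<N. 3 * of_bool ((q + 2 * ?y c) mod 3 = (p + 2 * ?x c) mod 3) - 1 :: real) = 0"
          using cancel[of "B div 3" h q p] AB False p q by simp
        then show ?thesis by (simp only: eq_commute)
      qed
      then show ?thesis using shifted_cells_info[OF p q] mods \<open>A \<noteq> B\<close> by simp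
    qed
  qed
qed

section \<open>Existence of the universally optimal plan\<close>

theorem theorem4p7:
  fixes m N :: nat
  assumes "1 \<le> m" and "1 \<le> N"
    and "\<exists>X. is_OA N (m - 1) 3 X"
  shows "\<exists>P. P \<in> plans_on_setup m N \<and>
           connected_plan 3 (3 * m) P \<and>
           POTB 3 (3 * m) (3 * N) P \<and>
           (\<forall>H. (\<forall>A<3 * m. contrast_mat 3 (H A)) \<longrightarrow>
              universally_optimal 3 (3 * m) (3 * N) H
                {Q \<in> plans_on_setup m N. connected_plan 3 (3 * m) Q} P)"
proof -
  obtain X where X: "is_OA N (m - 1) 3 X" using assms(3) by blast
  define P where "P = shifted_cells_plan N X"
  have on_setup: "P \<in> plans_on_setup m N"
    unfolding P_def by (rule shifted_cells_on_setup)
  then have P: "blocked_plan 3 (3 * m) (3 * N) P" by (simp add: plans_on_setup_def)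
  have info: "info P A B p q = (if A = B then real N * (real 3 * of_bool (p = q) - 1) else 0)"
    if "A < 3 * m" "B < 3 * m" "p < 3" "q < 3" for A B p q
    unfolding P_def by (rule shifted_cells_equal_info[OF X that])
  have connected: "connected_plan 3 (3 * m) P"
    by (rule equal_info_connected[OF P _ info]) (use assms(2) in simp_all)
  have "POTB 3 (3 * m) (3 * N) P"
    unfolding POTB_def
    by (intro allI impI orthogonal_through_blocksI) (use P info in \<open>auto simp: blocked_plan_def\<close>)
  moreover have "universally_optimal 3 (3 * m) (3 * N) H
      {Q \<in> plans_on_setup m N. connected_plan 3 (3 * m) Q} P"
    if H: "\<forall>A<3 * m. contrast_mat 3 (H A)" for H
    unfolding universally_optimal_def
  proof (intro conjI ballI allI impI)
    fix Q \<Phi> assume Q: "Q \<in> {Q \<in> plans_on_setup m N. connected_plan 3 (3 * m) Q}"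
      and \<Phi>: "optimality_criterion (3 * m * (3 - 1)) \<Phi>"
    let ?C = "C_mat 3 (3 * m) (3 * N) H Q"
    have Q': "blocked_plan 3 (3 * m) (3 * N) Q" using Q by (simp add: plans_on_setup_def)
    have trace: "(\<Sum>i<3 * m * (3 - 1). ?C $$ (i,i)) = (\<Sum>A<3*m. \<Sum>p<3. info Q A A p p)"
      by (rule C_mat_trace[OF Q' H])
    have "0 < (\<Sum>A<3*m. \<Sum>p<3. info Q A A p p)"
      by (rule sum_pos)
        (use assms(1) Q connected_info_trace_pos[of 3 "3*m" Q] in \<open>auto simp: lessThan_empty_iff\<close>)
    moreover have "(\<Sum>A<3*m. \<Sum>p<3. info Q A A p p) \<le> (\<Sum>A<3*m. 6 * real N)"
      using Q info_trace_le by (intro sum_mono) auto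
    ultimately have "\<Phi> ((real N * real 3) \<cdot>\<^sub>m 1\<^sub>m (3 * m * (3 - 1))) \<le> \<Phi> ?C"
      by (intro criterion_scalar_matrix_le[OF \<Phi> C_mat_nnd[OF Q' H]]) (simp_all add: trace[simplified])
    then show "\<Phi> (C_mat 3 (3 * m) (3 * N) H P) \<le> \<Phi> ?C"
      using equal_info_C_mat[OF P H info] by simp
  qed (use on_setup connected in simp)
  ultimately show ?thesis using on_setup connected by blast
qed

end
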